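(* Let $k\geq 1$ be an integer. Let $\mathcal{G}_1,\ldots,\mathcal{G}_k$ be nonempty families of connected graphs of order at least $2$, with minimum degrees $d_1,\ldots,d_k$, respectively, where $d_i=\delta(\mathcal{G}_i)=\min\{\delta(G) : G\in\mathcal{G}_i\}$. Let $H$ be a connected graph with maximum degree $\Delta(H)=\sum_{i=1}^{k} d_i$. Assume that the following conditions hold: (1) if $k=1$, then $H\notin\mathcal{G}_1$; (2) if $K_{d_i+1}\in\mathcal{G}_i$ for every $1\leq i\leq k$, then $H$ is not isomorphic to $K_{\Delta(H)+1}$; (3) if $K_2\in\mathcal{G}_i$ for every $1\leq i\leq k$, then $H$ is neither an odd cycle nor a complete graph. Then there is a partition of $V(H)$ into sets $V_1,\ldots,V_k$ such that $H[V_i]$ is $\mathcal{G}_i$-free for every $1\leq i\leq k$, and moreover the partition can be chosen so that, for some $i$, $H[V_i]$ is a maximum induced $\mathcal{G}_i$-free subgraph of $H$ (that is, $V_i$ has the largest cardinality among all $\mathcal{G}_i$-free subsets of $V(H)$).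
   Context: All graphs are finite and simple. $\delta(G)$ is the minimum degree of $G$. $H[W]$ denotes the subgraph of $H$ induced on $W\subseteq V(H)$. For a family $\mathcal{G}$ of graphs, a set $W\subseteq V(H)$ (equivalently the graph $H[W]$) is $\mathcal{G}$-free if $H[W]$ contains no subgraph (not necessarily induced) isomorphic to a member of $\mathcal{G}$. Membership of a graph in a family is understood up to isomorphism: $F\in\mathcal{G}$ means that $F$ is isomorphic to some member of $\mathcal{G}$. $K_n$ is the complete graph on $n$ vertices. The classes of a partition are pairwise disjoint with union $V(H)$; classes are allowed to be empty. *)

theory Defs
  imports "Graph_Theory.Graph_Theory" "HOL-Library.Disjoint_Sets"
begin

text \<open>
  Finite simple graphs are the symmetric digraphs of the locale \<^locale>\<open>graph\<close>: finite, without
  loops and parallel arcs, every edge being a pair of opposite arcs. The degree of a vertex is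
  therefore its out-degree.
\<close>

definition min_degree :: "('a, 'b) pre_digraph \<Rightarrow> nat" where
  "min_degree G = Min (out_degree G ` verts G)"

definition max_degree :: "('a, 'b) pre_digraph \<Rightarrow> nat" where
  "max_degree G = Max (out_degree G ` verts G)"

text \<open>A family may be infinite; on a nonempty set of naturals \<^const>\<open>Inf\<close> is the minimum.\<close>

definition family_min_degree :: "('a, 'b) pre_digraph set \<Rightarrow> nat" where
  "family_min_degree \<G> = (INF G\<in>\<G>. min_degree G)"

definition in_family :: "('c, 'd) pre_digraph \<Rightarrow> ('a, 'b) pre_digraph set \<Rightarrow> bool" where
  "in_family H \<G> \<longleftrightarrow> (\<exists>F\<in>\<G>. digraph_iso F H)"

text \<open>
  \<^const>\<open>subgraph\<close> allows arbitrary subdigraphs, but one that is isomorphic to a symmetric digraph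
  is itself symmetric.
\<close>

definition family_free :: "('a, 'b) pre_digraph set \<Rightarrow> ('c, 'd) pre_digraph \<Rightarrow> bool" where
  "family_free \<G> H \<longleftrightarrow> \<not> (\<exists>S. subgraph S H \<and> in_family S \<G>)"

definition max_family_free_set ::
    "('a, 'b) pre_digraph set \<Rightarrow> ('c, 'd) pre_digraph \<Rightarrow> 'c set \<Rightarrow> bool" where
  "max_family_free_set \<G> H W \<longleftrightarrow>
     W \<subseteq> verts H \<and> family_free \<G> (H \<restriction> W) \<and>
     (\<forall>U. U \<subseteq> verts H \<and> family_free \<G> (H \<restriction> U) \<longrightarrow> card U \<le> card W)"

text \<open>The cycle on \<open>n\<close> vertices; meaningful for \<open>n \<ge> 3\<close>.\<close>

definition cycle_graph :: "nat \<Rightarrow> nat pair_pre_digraph" where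
  "cycle_graph n = \<lparr> pverts = {..<n},
     parcs = {(i, j). i < n \<and> j < n \<and> (j = Suc i mod n \<or> i = Suc j mod n)} \<rparr>"

definition odd_cycle :: "('a, 'b) pre_digraph \<Rightarrow> bool" where
  "odd_cycle G \<longleftrightarrow> (\<exists>n\<ge>3. odd n \<and> digraph_iso (with_proj (cycle_graph n)) G)"

end

theory Submission
  imports Defs
begin

text \<open>
  For a class \<open>i\<close> let \<open>p = d i\<close> and let \<open>r\<close> be the sum of the other \<open>d j\<close>. If \<open>S\<close> is a maximum
  \<open>\<G> i\<close>-free set, every vertex outside \<open>S\<close> has at least \<open>p\<close> neighbours in \<open>S\<close>, hence at most \<open>r\<close> outside.
  If \<open>V - S\<close> induces no \<open>r\<close>-regular component, it is \<open>(r - 1)\<close>-degenerate, and a greedy colouring splits it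
  into sets free for the other families. So only \<open>r\<close>-regular (bad) components have to be avoided,
  and for this \<open>S\<close> is chosen with as few of them as possible.

  Exchanging a vertex \<open>v\<close> of a bad component \<open>C\<close> with a neighbour \<open>x \<in> S\<close> yields another maximum free set;
  by minimality \<open>x\<close> then lies in a new bad component. Unless the graph is \<open>K\<close> on \<open>p + r + 1\<close> vertices, one can
  always pick such a pair with \<open>C - {v}\<close> connected, \<open>v\<close> the only neighbour of \<open>x\<close> in \<open>C\<close>, and \<open>v\<close> not the vertex
  that has just entered \<open>C\<close>. Iterating leaves pairwise disjoint remainders \<open>C - {v}\<close> behind. For \<open>r \<ge> 2\<close> a
  degree count shows that the new vertex is never adjacent to an earlier remainder, so that they
  would grow without bound.

  On the excluded complete graph one takes a class \<open>i\<close> for which the complete graph on \<open>p + 1\<close> vertices is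
  not forbidden; then \<open>V - S\<close> has at most \<open>r\<close> vertices. Some class has \<open>r \<ge> 2\<close> unless \<open>k = 1\<close>, which is
  immediate, or \<open>k = 2\<close> and \<open>d 1 = d 2 = 1\<close>, when the graph is a path or a cycle.
\<close>

subsection \<open>Finite simple graphs as relations\<close>

locale finite_sgraph =
  fixes V :: "'a set" and adj :: "'a \<Rightarrow> 'a \<Rightarrow> bool"
  assumes finite_V: "finite V"
    and adj_in_V: "adj u v \<Longrightarrow> v \<in> V"
    and adj_sym: "adj u v \<Longrightarrow> adj v u"
    and adj_irrefl: "\<not> adj u u"
begin

section \<open>Cuts, connectivity and greedy partitions\<close>

definition nb :: "'a \<Rightarrow> 'a set" where
  "nb u = {v. adj u v}"

text \<open>Connectivity through cuts instead of walks, because later arguments compare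
  \<open>C\<close> with a subset that no edge leaves. The empty set and singletons count as
  connected.\<close>

definition connected_set :: "'a set \<Rightarrow> bool" where
  "connected_set C \<longleftrightarrow> (\<forall>A\<subseteq>C. A \<noteq> {} \<longrightarrow> A \<noteq> C \<longrightarrow> (\<exists>u\<in>A. \<exists>w\<in>C - A. adj u w))"

definition clique :: "'a set \<Rightarrow> bool" where
  "clique C \<longleftrightarrow> (\<forall>a\<in>C. \<forall>b\<in>C. a \<noteq> b \<longrightarrow> adj a b)"

lemma adj_commute: "adj u v \<longleftrightarrow> adj v u"
  using adj_sym by blast

lemma in_nb [simp]: "v \<in> nb u \<longleftrightarrow> adj u v"
  by (simp add: nb_def)

lemma nb_subset: "nb u \<subseteq> V"
  using adj_in_V by auto

lemma finite_nb [simp]: "finite (nb u)"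
  using nb_subset finite_V finite_subset by blast

lemma connected_set_closed_eq:
  assumes "connected_set C" "A \<subseteq> C" "A \<noteq> {}" "\<And>a. a \<in> A \<Longrightarrow> nb a \<inter> C \<subseteq> A"
  shows "A = C"
proof (rule ccontr)
  assume "A \<noteq> C"
  then obtain u w where "u \<in> A" "w \<in> C - A" "adj u w"
    using assms(1-3) unfolding connected_set_def by meson
  then show False using assms(4)[of u] by auto
qed

lemma connected_set_insert:
  assumes "connected_set A" "a \<in> A" "adj a w"
  shows "connected_set (insert w A)"
  unfolding connected_set_def
proof (intro allI impI)
  fix B assume B: "B \<subseteq> insert w A" "B \<noteq> {}" "B \<noteq> insert w A"
  show "\<exists>u\<in>B. \<exists>v\<in>insert w A - B. adj u v"
  proof (cases "B \<inter> A = {} \<or> B \<inter> A = A")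
    case False
    then have "B \<inter> A \<subseteq> A" "B \<inter> A \<noteq> {}" "B \<inter> A \<noteq> A" by auto
    then obtain u v where "u \<in> B \<inter> A" "v \<in> A - B \<inter> A" "adj u v"
      using assms(1) unfolding connected_set_def by meson
    then show ?thesis by blast
  next
    case True
    then show ?thesis
    proof
      assume e: "B \<inter> A = {}"
      then have "B = {w}" "w \<notin> A" using B by auto
      then show ?thesis using assms adj_sym by blast
    next
      assume "B \<inter> A = A"
      then have "A \<subseteq> B" "w \<notin> B" using B by auto
      then show ?thesis using assms B by blast
    qed
  qed
qed

lemma connected_set_clique: "clique C \<Longrightarrow> connected_set C"
  unfolding clique_def connected_set_def by (metis Diff_iff subset_antisym subset_eq ex_in_conv)

lemma clique_subset: "clique C \<Longrightarrow> A \<subseteq> C \<Longrightarrow> clique A"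
  unfolding clique_def by blast

text \<open>A maximal connected proper subset of \<open>C\<close> containing \<open>y\<close> has an
  edge to some \<open>w\<close> in the rest of \<open>C\<close>. Adding \<open>w\<close> keeps it
  connected, so by maximality only \<open>w\<close> was missing.\<close>

lemma ex_non_cut_vertex:
  assumes "connected_set C" "finite C" "y \<in> C" "C \<noteq> {y}"
  obtains v where "v \<in> C" "v \<noteq> y" "connected_set (C - {v})"
proof -
  define \<A> where "\<A> = {A. A \<subseteq> C \<and> A \<noteq> C \<and> y \<in> A \<and> connected_set A}"
  have "finite \<A>" unfolding \<A>_def using assms(2) by auto
  moreover have "{y} \<in> \<A>" using assms unfolding \<A>_def connected_set_def by blast
  ultimately obtain A where A: "A \<in> \<A>" and mx: "\<And>B. B \<in> \<A> \<Longrightarrow> A \<subseteq> B \<Longrightarrow> A = B"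
    using finite_has_maximal[of \<A>] by (metis empty_iff)
  have sub: "A \<subseteq> C" "A \<noteq> C" "y \<in> A" "connected_set A" using A unfolding \<A>_def by auto
  obtain a w where w: "a \<in> A" "w \<in> C - A" "adj a w"
    using assms(1) sub unfolding connected_set_def by (metis empty_iff)
  have "insert w A = C"
  proof (rule ccontr)
    assume "insert w A \<noteq> C"
    moreover have "connected_set (insert w A)" using connected_set_insert sub w by blast
    ultimately have "insert w A \<in> \<A>" using w sub unfolding \<A>_def by auto
    then show False using mx w by blast
  qed
  then have "C - {w} = A" using w by auto
  then show ?thesis using that[of w] w sub by auto
qed

text \<open>Induction on the size of \<open>R\<close>: peel off a vertex \<open>u\<close> of small
  degree, partition the rest, put \<open>u\<close> back. \<open>P j\<close> will be freeness for the
  family with index \<open>j\<close>, and \<open>d j\<close> its minimum degree.\<close>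

lemma greedy_partition:
  assumes J: "finite J" and R: "R \<subseteq> V"
    and empty: "\<And>j. j \<in> J \<Longrightarrow> P j {}"
    and ext: "\<And>j A v. j \<in> J \<Longrightarrow> A \<subseteq> V \<Longrightarrow> v \<in> V \<Longrightarrow> P j A \<Longrightarrow> card (nb v \<inter> A) < d j \<Longrightarrow>
      P j (insert v A)"
    and degenerate: "\<And>W. W \<subseteq> R \<Longrightarrow> W \<noteq> {} \<Longrightarrow> \<exists>u\<in>W. card (nb u \<inter> W) < sum d J"
  shows "\<exists>U. disjoint_family_on U J \<and> (\<Union>j\<in>J. U j) = R \<and> (\<forall>j\<in>J. P j (U j))"
  using R degenerate
proof (induction "card R" arbitrary: R rule: less_induct)
  case less
  show ?case
  proof (cases "R = {}")
    case True
    then show ?thesis using empty by (intro exI[of _ "\<lambda>_. {}"]) (auto simp: disjoint_family_on_def)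
  next
    case False
    then obtain u where u: "u \<in> R" "card (nb u \<inter> R) < sum d J" using less.prems(2)[of R] by blast
    have finR: "finite R" using less.prems(1) finite_V finite_subset by blast
    have "card (R - {u}) < card R" using u finR by (intro card_Diff1_less) auto
    moreover have "R - {u} \<subseteq> V" using less.prems(1) by blast
    moreover have "\<exists>u\<in>W. card (nb u \<inter> W) < sum d J" if "W \<subseteq> R - {u}" "W \<noteq> {}" for W
      using less.prems(2)[of W] that by blast
    ultimately obtain U where U: "disjoint_family_on U J" "(\<Union>j\<in>J. U j) = R - {u}" "\<forall>j\<in>J. P j (U j)"
      using less.hyps[of "R - {u}"] by blast
    \<comment> \<open>Pigeonhole: the classes are disjoint and \<open>u\<close> has fewer than
      \<open>sum d J\<close> neighbours in \<open>R\<close>, so not every class \<open>j\<close> can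
      hold \<open>d j\<close> of them.\<close>
    have "\<exists>j\<in>J. card (nb u \<inter> U j) < d j"
    proof (rule ccontr)
      assume "\<not> ?thesis"
      then have "sum d J \<le> (\<Sum>j\<in>J. card (nb u \<inter> U j))" by (intro sum_mono) auto
      also have "\<dots> = card (\<Union>j\<in>J. nb u \<inter> U j)"
        using J U(1) by (subst card_UN_disjoint) (auto simp: disjoint_family_on_def)
      also have "\<dots> \<le> card (nb u \<inter> R)" using U(2) by (intro card_mono) auto
      finally show False using u by simp
    qed
    then obtain j where j: "j \<in> J" "card (nb u \<inter> U j) < d j" by blast
    define U' where "U' = U(j := insert u (U j))"
    have sub: "U i \<subseteq> R - {u}" if "i \<in> J" for i using U(2) that by blast
    have "U j \<subseteq> V" "u \<in> V" using sub[OF j(1)] less.prems(1) u(1) by auto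
    then have "P j (insert u (U j))" using ext[OF j(1) _ _ _ j(2)] U(3) j(1) by simp
    then have "\<forall>i\<in>J. P i (U' i)" using U(3) unfolding U'_def by simp
    moreover have "disjoint_family_on U' J"
      unfolding disjoint_family_on_def
    proof (intro ballI impI)
      fix a b assume ab: "a \<in> J" "b \<in> J" "a \<noteq> b"
      then have "U a \<inter> U b = {}" using U(1) unfolding disjoint_family_on_def by simp
      moreover have "u \<notin> U a" "u \<notin> U b" using sub ab by auto
      ultimately show "U' a \<inter> U' b = {}" using ab(3) unfolding U'_def by auto
    qed
    moreover have "(\<Union>i\<in>J. U' i) = R"
    proof -
      have "(\<Union>i\<in>J. U' i) = insert u (\<Union>i\<in>J. U i)"
        using j unfolding U'_def by (auto split: if_splits)
      also have "\<dots> = R" unfolding U(2) using u(1) by auto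
      finally show ?thesis .
    qed
    ultimately show ?thesis by (intro exI[of _ U'] conjI)
  qed
qed

section \<open>Paths, cycles and their bipartitions\<close>

definition independent :: "'a set \<Rightarrow> bool" where
  "independent U \<longleftrightarrow> (\<forall>a\<in>U. \<forall>b\<in>U. \<not> adj a b)"

definition path_enum :: "(nat \<Rightarrow> 'a) \<Rightarrow> nat \<Rightarrow> bool" where
  "path_enum f n \<longleftrightarrow> inj_on f {..<n} \<and> f ` {..<n} \<subseteq> V \<and> (\<forall>i. Suc i < n \<longrightarrow> adj (f i) (f (Suc i)))"

text \<open>A longest path does it: interior vertices already have two neighbours on the path and
  the ends cannot be prolonged, so no edge leaves the path and connectivity makes it spanning. The
  degree bound then leaves only an edge between the two ends as a possible chord.\<close>

lemma ex_spanning_path: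
  assumes conn: "connected_set V" and ne: "V \<noteq> {}" and deg: "\<And>v. v \<in> V \<Longrightarrow> card (nb v) \<le> 2"
  obtains f n where "path_enum f n" "f ` {..<n} = V"
    "\<And>i j. i < j \<Longrightarrow> j < n \<Longrightarrow> adj (f i) (f j) \<Longrightarrow> j = Suc i \<or> i = 0 \<and> Suc j = n"
proof -
  obtain a where a: "a \<in> V" using ne by blast
  have bound: "n \<le> card V" if "path_enum f n" for f n
    using that card_inj_on_le[of f "{..<n}" V] finite_V unfolding path_enum_def by auto
  have "\<exists>n. (\<exists>f. path_enum f n) \<and> (\<forall>m. (\<exists>f. path_enum f m) \<longrightarrow> m \<le> n)"
  proof (rule ex_has_greatest_nat[of "\<lambda>n. \<exists>f. path_enum f n" 1 "\<lambda>n. n" "Suc (card V)"])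
    show "\<exists>f. path_enum f 1"
      using a by (intro exI[of _ "\<lambda>_. a"]) (auto simp: path_enum_def inj_on_def)
    show "\<forall>n. (\<exists>f. path_enum f n) \<longrightarrow> n < Suc (card V)" using bound by (auto simp: less_Suc_eq_le)
  qed
  then obtain n f where f: "path_enum f n" and mx: "\<And>m g. path_enum g m \<Longrightarrow> m \<le> n" by blast
  have "path_enum (\<lambda>_. a) 1" using a by (auto simp: path_enum_def inj_on_def)
  then have n1: "1 \<le> n" using mx by blast
  have inj: "inj_on f {..<n}" and sub: "f ` {..<n} \<subseteq> V"
    and consec: "\<And>i. Suc i < n \<Longrightarrow> adj (f i) (f (Suc i))"
    using f unfolding path_enum_def by auto
  have inner: "nb (f i) = {f (i - 1), f (Suc i)}" if i: "0 < i" "Suc i < n" for i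
  proof -
    have "{f (i - 1), f (Suc i)} \<subseteq> nb (f i)"
      using consec[of i] consec[of "i - 1"] i adj_sym by auto
    moreover have "f (i - 1) \<noteq> f (Suc i)" using inj i by (auto dest: inj_onD)
    then have "card {f (i - 1), f (Suc i)} = 2" by simp
    moreover have "f i \<in> V" using sub i by (simp add: image_subset_iff)
    then have "card (nb (f i)) \<le> 2" by (rule deg)
    ultimately show ?thesis using card_seteq[of "nb (f i)" "{f (i - 1), f (Suc i)}"] by simp
  qed
  have last: "nb (f (n - 1)) \<subseteq> f ` {..<n}"
  proof (rule ccontr)
    assume "\<not> ?thesis"
    then obtain w where w: "adj (f (n - 1)) w" "w \<notin> f ` {..<n}" by (metis in_nb subsetI)
    have "path_enum (f(n := w)) (Suc n)"
      unfolding path_enum_def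
    proof (intro conjI allI impI)
      show "inj_on (f(n := w)) {..<Suc n}"
        using inj w unfolding lessThan_Suc by (auto simp: inj_on_def)
      show "(f(n := w)) ` {..<Suc n} \<subseteq> V" using sub w adj_in_V unfolding lessThan_Suc by auto
      fix i assume "Suc i < Suc n"
      then show "adj ((f(n := w)) i) ((f(n := w)) (Suc i))"
        using consec[of i] w by (cases "Suc i = n") auto
    qed
    then show False using mx by fastforce
  qed
  have first: "nb (f 0) \<subseteq> f ` {..<n}"
  proof (rule ccontr)
    assume "\<not> ?thesis"
    then obtain w where w: "adj (f 0) w" "w \<notin> f ` {..<n}" by (metis in_nb subsetI)
    define g where "g = case_nat w f"
    have img: "g ` {..<Suc n} = insert w (f ` {..<n})"
      unfolding g_def lessThan_Suc_eq_insert_0 by (auto simp: image_image)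
    have "path_enum g (Suc n)"
      unfolding path_enum_def
    proof (intro conjI allI impI)
      show "inj_on g {..<Suc n}"
        using inj w unfolding g_def lessThan_Suc_eq_insert_0 by (auto simp: inj_on_def)
      show "g ` {..<Suc n} \<subseteq> V" using sub w adj_in_V unfolding img by auto
      fix i assume "Suc i < Suc n"
      then show "adj (g i) (g (Suc i))"
        using consec w adj_sym unfolding g_def by (cases i) auto
    qed
    then show False using mx by fastforce
  qed
  have "nb b \<subseteq> f ` {..<n}" if "b \<in> f ` {..<n}" for b
  proof -
    obtain i where i: "i < n" "b = f i" using \<open>b \<in> f ` {..<n}\<close> by blast
    consider "i = 0" | "i = n - 1" | "0 < i" "Suc i < n" using i by linarith
    then show ?thesis
    proof cases
      case 3
      then show ?thesis using inner[OF 3] i by auto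
    qed (use first last i in auto)
  qed
  moreover have "f 0 \<in> f ` {..<n}" using n1 by simp
  then have "f ` {..<n} \<noteq> {}" by blast
  ultimately have img: "f ` {..<n} = V" using connected_set_closed_eq[OF conn sub] by blast
  have adj_cases: "j = Suc i \<or> i = 0 \<and> Suc j = n" if ij: "i < j" "j < n" "adj (f i) (f j)" for i j
  proof -
    have eq: "a = b" if "f a = f b" "a < n" "b < n" for a b
      using inj_onD[OF inj that(1)] that(2,3) by blast
    have "j = Suc i" if i: "0 < i"
    proof -
      have "Suc i < n" using ij(1,2) by simp
      then have "f j = f (i - 1) \<or> f j = f (Suc i)" using inner[OF i] ij(3) in_nb by blast
      then have "j = i - 1 \<or> j = Suc i" using eq[of j "i - 1"] eq[of j "Suc i"] \<open>Suc i < n\<close> ij(2) by linarith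
      then show ?thesis using ij(1) by linarith
    qed
    moreover have "i = j - 1" if j: "Suc j < n"
    proof -
      have "0 < j" using ij(1) by simp
      then have "f i = f (j - 1) \<or> f i = f (Suc j)" using inner[OF _ j] adj_sym[OF ij(3)] in_nb by blast
      then have "i = j - 1 \<or> i = Suc j" using eq[of i "j - 1"] eq[of i "Suc j"] j ij(1) by linarith
      then show ?thesis using ij(1) by linarith
    qed
    ultimately show ?thesis using ij by linarith
  qed
  show thesis by (rule that[OF f img adj_cases])
qed

text \<open>The vertices with even index form the larger side. Path edges change the parity of the
  index, and only the closing edge of an odd cycle would not.\<close>

lemma even_cycle_or_path_bipartition:
  assumes f: "path_enum f n" "f ` {..<n} = V"
    and adj_cases: "\<And>i j. i < j \<Longrightarrow> j < n \<Longrightarrow> adj (f i) (f j) \<Longrightarrow> j = Suc i \<or> i = 0 \<and> Suc j = n"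
    and not_odd: "\<not> (odd n \<and> 3 \<le> n \<and> adj (f 0) (f (n - 1)))"
  shows "\<exists>A\<subseteq>V. independent A \<and> independent (V - A) \<and> (\<forall>U\<subseteq>V. independent U \<longrightarrow> card U \<le> card A)"
proof -
  have inj: "inj_on f {..<n}" and consec: "\<And>i. Suc i < n \<Longrightarrow> adj (f i) (f (Suc i))"
    using f unfolding path_enum_def by auto
  have parity: "even i \<noteq> even j" if ij: "i < n" "j < n" "adj (f i) (f j)" for i j
  proof -
    have *: "even i \<noteq> even j" if "i < j" "j < n" "adj (f i) (f j)" for i j
      using adj_cases[OF that]
    proof
      assume e: "i = 0 \<and> Suc j = n"
      \<comment> \<open>The edge joins \<open>0\<close> and \<open>n - 1\<close>. For odd
        \<open>n\<close>, the value \<open>1\<close> contradicts \<open>i < j\<close>, and the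
        values from \<open>3\<close> on contradict \<open>not_odd\<close>; so \<open>n - 1\<close>
        is odd.\<close>
      then have "odd n \<Longrightarrow> n = 1 \<or> 3 \<le> n" by presburger
      then show ?thesis using e that not_odd by auto
    qed simp
    have "i \<noteq> j" using ij adj_irrefl by auto
    then show ?thesis using *[of i j] *[of j i] ij adj_sym by (metis linorder_neqE_nat)
  qed
  define A where "A = f ` {i. i < n \<and> even i}"
  have VA: "V - A \<subseteq> f ` {i. i < n \<and> odd i}" using f(2) unfolding A_def by auto
  have "independent A" using parity unfolding independent_def A_def by auto
  moreover have "independent (V - A)" using parity VA unfolding independent_def by blast
  moreover have "card U \<le> card A" if U: "U \<subseteq> V" "independent U" for U
  proof -
    define I where "I = {i. i < n \<and> f i \<in> U}"
    have UI: "U = f ` I" using U f(2) unfolding I_def by auto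
    have "card U = card I" unfolding UI using inj by (intro card_image) (auto simp: I_def inj_on_def)
    \<comment> \<open>Rounding down to an even index is injective on \<open>I\<close>: two distinct
      indices with the same image are consecutive, hence adjacent, while \<open>U\<close> is
      independent.\<close>
    also have "\<dots> \<le> card {i. i < n \<and> even i}"
    proof (rule card_inj_on_le[where f = "\<lambda>i. 2 * (i div 2)"])
      have "i = j" if ij: "i \<in> I" "j \<in> I" "2 * (i div 2) = 2 * (j div 2)" for i j
      proof (rule ccontr)
        assume "i \<noteq> j"
        then have "i = Suc j \<or> j = Suc i" using ij(3) by presburger
        then have "adj (f i) (f j)" using consec adj_sym ij unfolding I_def by auto
        then show False using U ij unfolding independent_def I_def by auto
      qed
      then show "inj_on (\<lambda>i. 2 * (i div 2)) I" by (auto intro: inj_onI)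
      show "(\<lambda>i. 2 * (i div 2)) ` I \<subseteq> {i. i < n \<and> even i}" unfolding I_def by auto
    qed simp
    also have "\<dots> = card A" unfolding A_def
      using inj by (intro card_image[symmetric]) (auto simp: inj_on_def)
    finally show ?thesis .
  qed
  moreover have "A \<subseteq> V" using f(2) unfolding A_def by auto
  ultimately show ?thesis by blast
qed

end

subsection \<open>Exchanges in a maximum set\<close>

text \<open>\<open>P U\<close> abstracts that \<open>U\<close> induces a free subgraph;
  \<open>p\<close> will be the minimum degree of the family and \<open>r\<close> the sum of those of
  the other families. The exchange argument sees the family only through these closure properties of
  \<open>P\<close>.\<close>

locale maximum_set_swap = finite_sgraph +
  fixes P :: "'a set \<Rightarrow> bool" and p r :: nat
  assumes P_empty: "P {}"
    and P_mono: "P B \<Longrightarrow> A \<subseteq> B \<Longrightarrow> P A"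
    and P_insert: "A \<subseteq> V \<Longrightarrow> v \<in> V \<Longrightarrow> P A \<Longrightarrow> card (nb v \<inter> A) < p \<Longrightarrow> P (insert v A)"
    and degree_le: "v \<in> V \<Longrightarrow> card (nb v) \<le> p + r"
    and p_pos: "0 < p"
    and r_pos: "0 < r"
begin

section \<open>Maximum sets and the regular components outside them\<close>

definition max_set :: "'a set \<Rightarrow> bool" where
  "max_set S \<longleftrightarrow> S \<subseteq> V \<and> P S \<and> (\<forall>U\<subseteq>V. P U \<longrightarrow> card U \<le> card S)"

text \<open>\<open>C\<close> is an \<open>r\<close>-regular component of the graph outside
  \<open>S\<close>. Such components are the only obstruction to degeneracy there; see
  \<open>no_bad_degenerate\<close>.\<close>

definition bad :: "'a set \<Rightarrow> 'a set \<Rightarrow> bool" where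
  "bad S C \<longleftrightarrow> C \<noteq> {} \<and> C \<subseteq> V - S \<and> connected_set C \<and>
     (\<forall>u\<in>C. nb u - S \<subseteq> C \<and> card (nb u - S) = r)"

definition optimal :: "'a set \<Rightarrow> bool" where
  "optimal S \<longleftrightarrow> max_set S \<and> (\<forall>U. max_set U \<longrightarrow> card {C. bad S C} \<le> card {C. bad U C})"

lemma finite_bad: "finite {C. bad S C}"
proof (rule finite_subset)
  show "{C. bad S C} \<subseteq> Pow V" unfolding bad_def by auto
qed (simp add: finite_V)

lemma ex_max_set: "\<exists>S. max_set S"
proof -
  have "\<exists>S. (S \<subseteq> V \<and> P S) \<and> (\<forall>U. U \<subseteq> V \<and> P U \<longrightarrow> card U \<le> card S)"
  proof (rule ex_has_greatest_nat)
    show "{} \<subseteq> V \<and> P {}" using P_empty by simp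
    show "\<forall>U. U \<subseteq> V \<and> P U \<longrightarrow> card U < Suc (card V)"
      using finite_V by (simp add: card_mono less_Suc_eq_le)
  qed
  then show ?thesis unfolding max_set_def by auto
qed

lemma ex_optimal: "\<exists>S. optimal S"
proof -
  obtain S where "max_set S" using ex_max_set by blast
  from ex_has_least_nat[of max_set, OF this, of "\<lambda>S. card {C. bad S C}"]
  show ?thesis unfolding optimal_def .
qed

lemma optimalD: "optimal S \<Longrightarrow> max_set S"
  by (simp add: optimal_def)

lemma max_set_subset: "max_set S \<Longrightarrow> S \<subseteq> V"
  by (simp add: max_set_def)

lemma card_nb_split: "card (nb v \<inter> S) + card (nb v - S) = card (nb v)"
  by (simp add: card_Int_Diff[symmetric])

text \<open>With fewer than \<open>p\<close> neighbours in \<open>S\<close>, the vertex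
  \<open>v\<close> could join \<open>S\<close>, against maximality.\<close>

lemma inner_degree_ge:
  assumes "max_set S" "v \<in> V" "v \<notin> S"
  shows "p \<le> card (nb v \<inter> S)"
proof (rule ccontr)
  assume "\<not> ?thesis"
  then have "P (insert v S)" using P_insert assms unfolding max_set_def by auto
  moreover have "finite S" using assms finite_V finite_subset max_set_subset by blast
  then have "card (insert v S) = Suc (card S)" using assms by simp
  moreover have "insert v S \<subseteq> V" "\<forall>U\<subseteq>V. P U \<longrightarrow> card U \<le> card S"
    using assms unfolding max_set_def by auto
  ultimately show False using Suc_n_not_le_n by metis
qed

lemma outer_degree_le:
  assumes "max_set S" "v \<in> V" "v \<notin> S"
  shows "card (nb v - S) \<le> r"
  using inner_degree_ge[OF assms] degree_le[OF assms(2)] card_nb_split[of v S] by linarith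

lemma outer_degree_contr:
  assumes "max_set S" "v \<in> V" "v \<notin> S" "A \<subseteq> nb v - S" "r < card A"
  shows False
  using outer_degree_le[OF assms(1-3)] card_mono[OF _ assms(4)] assms(5) by simp

lemma bad_inner_degree:
  assumes "max_set S" "bad S C" "v \<in> C"
  shows "card (nb v \<inter> S) = p"
proof -
  have "v \<in> V" "v \<notin> S" "card (nb v - S) = r" using assms unfolding bad_def by auto
  then show ?thesis
    using inner_degree_ge[of S v] degree_le[of v] card_nb_split[of v S] assms by linarith
qed

section \<open>Exchanging a vertex of a bad component\<close>

text \<open>Once \<open>x\<close> has left, \<open>v\<close> sees only \<open>p - 1\<close> vertices
  of the set and may enter; the size is unchanged.\<close>

lemma swap_max_set:
  assumes "max_set S" "v \<in> V" "v \<notin> S" "x \<in> S" "adj v x" "card (nb v \<inter> S) = p"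
  shows "max_set (insert v (S - {x}))"
proof -
  have fin: "finite S" using assms finite_V finite_subset max_set_subset by blast
  have "nb v \<inter> (S - {x}) = nb v \<inter> S - {x}" by auto
  then have "card (nb v \<inter> (S - {x})) < p" using assms p_pos by simp
  then have "P (insert v (S - {x}))"
    using assms P_insert[of "S - {x}" v] P_mono[of S "S - {x}"] unfolding max_set_def by blast
  moreover have "card (insert v (S - {x})) = card S"
    using assms fin card_Suc_Diff1[of S x] by simp
  ultimately show ?thesis using assms unfolding max_set_def by auto
qed

lemma bad_swap_max_set:
  assumes "max_set S" "bad S C" "v \<in> C" "x \<in> S" "adj v x"
  shows "max_set (insert v (S - {x}))"
  using swap_max_set[of S v x] bad_inner_degree[of S C v] assms unfolding bad_def by blast

lemma bad_step: "bad S C \<Longrightarrow> u \<in> C \<Longrightarrow> adj u w \<Longrightarrow> w \<notin> S \<Longrightarrow> w \<in> C"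
  unfolding bad_def by (metis Diff_iff in_nb subsetD)

lemma bad_outer_degree: "bad S C \<Longrightarrow> u \<in> C \<Longrightarrow> card (nb u - S) = r"
  unfolding bad_def by auto

lemma bad_subset: "bad S C \<Longrightarrow> C \<subseteq> V - S"
  unfolding bad_def by auto

lemma bad_closed_eq:
  assumes "bad S C" "A \<subseteq> C" "A \<noteq> {}" "\<And>a. a \<in> A \<Longrightarrow> nb a - S \<subseteq> A"
  shows "A = C"
proof (rule connected_set_closed_eq)
  show "connected_set C" "A \<subseteq> C" "A \<noteq> {}" using assms unfolding bad_def by auto
  show "nb a \<inter> C \<subseteq> A" if "a \<in> A" for a
    using assms(4)[OF that] assms(1) unfolding bad_def by auto
qed

lemma bad_absorbs:
  assumes "bad S C" "connected_set D" "D \<subseteq> V - S" "D \<inter> C \<noteq> {}"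
  shows "D \<subseteq> C"
proof -
  have "D \<inter> C = D"
  proof (rule connected_set_closed_eq)
    show "nb a \<inter> D \<subseteq> D \<inter> C" if "a \<in> D \<inter> C" for a
      using assms(1,3) that unfolding bad_def by auto
  qed (use assms in auto)
  then show ?thesis by blast
qed

lemma bad_eq:
  assumes "bad S C" "bad S D" "C \<inter> D \<noteq> {}"
  shows "C = D"
proof
  have "connected_set C" "connected_set D" "C \<subseteq> V - S" "D \<subseteq> V - S"
    using assms unfolding bad_def by auto
  then show "C \<subseteq> D" "D \<subseteq> C"
    using bad_absorbs[of S C D] bad_absorbs[of S D C] assms by auto
qed

text \<open>Every bad component of \<open>S'\<close> avoiding \<open>x\<close> was already bad for
  \<open>S\<close> and differs from \<open>C\<close>. If none contained \<open>x\<close>, the number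
  of bad components would drop; since at most one contains \<open>x\<close>, the number does not
  rise.\<close>

lemma swap_optimal:
  assumes opt: "optimal S" and bad: "bad S C" and v: "v \<in> C" and x: "x \<in> S" "adj v x"
    and S': "S' = insert v (S - {x})"
  shows "optimal S'" and "\<exists>C'. bad S' C' \<and> x \<in> C'"
proof -
  have max: "max_set S" "max_set S'"
    using opt optimalD bad_swap_max_set bad v x S' by blast+
  have vV: "v \<in> V" "v \<notin> S" using bad v unfolding bad_def by auto
  have old: "bad S D \<and> D \<noteq> C" if D: "bad S' D" "x \<notin> D" for D
  proof
    have DV: "D \<subseteq> V - S'" "connected_set D" "D \<noteq> {}"
      using D unfolding bad_def by auto
    have vD: "v \<notin> D" using DV S' by auto
    then show "D \<noteq> C" using v by auto
    have "nb u - S \<subseteq> D \<and> card (nb u - S) = r" if u: "u \<in> D" for u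
    proof -
      have *: "nb u - S' \<subseteq> D" "card (nb u - S') = r" using D u unfolding bad_def by auto
      have uS: "u \<in> V" "u \<notin> S" using u DV D S' by auto
      have nx: "x \<notin> nb u" using * D S' x vV by auto
      \<comment> \<open>If \<open>u\<close> were adjacent to \<open>v\<close>, then \<open>v\<close>
        would join its \<open>r\<close> neighbours outside \<open>S'\<close>, giving
        \<open>r + 1\<close> neighbours outside \<open>S\<close>.\<close>
      have "v \<notin> nb u"
      proof
        assume "v \<in> nb u"
        then have "nb u - S = insert v (nb u - S')" using nx S' vV by auto
        then have "card (nb u - S) = Suc r" using * S' by simp
        then show False using outer_degree_le[OF max(1) uS] by simp
      qed
      then have "nb u - S = nb u - S'" using nx S' by auto
      then show ?thesis using * by simp
    qed
    then show "bad S D" using DV D S' unfolding bad_def by auto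
  qed
  show ex: "\<exists>C'. bad S' C' \<and> x \<in> C'"
  proof (rule ccontr)
    assume "\<not> ?thesis"
    then have "{D. bad S' D} \<subseteq> {D. bad S D} - {C}" using old by auto
    then have "card {D. bad S' D} \<le> card ({D. bad S D} - {C})"
      by (simp add: card_mono finite_bad)
    also have "\<dots> < card {D. bad S D}" using bad finite_bad
      by (intro card_Diff1_less) auto
    finally show False using opt max unfolding optimal_def by auto
  qed
  then obtain C' where C': "bad S' C'" "x \<in> C'" by blast
  have "{D. bad S' D} \<subseteq> insert C' ({D. bad S D} - {C})"
    using old C' bad_eq by blast
  then have "card {D. bad S' D} \<le> card (insert C' ({D. bad S D} - {C}))"
    by (simp add: card_mono finite_bad)
  also have "\<dots> \<le> Suc (card ({D. bad S D} - {C}))" by (rule card_insert_le_m1) auto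
  also have "\<dots> = card {D. bad S D}" using bad finite_bad by (intro card_Suc_Diff1) auto
  finally show "optimal S'" using opt max unfolding optimal_def by fastforce
qed

lemma bad_not_singleton: "bad S C \<Longrightarrow> C \<noteq> {y}"
proof
  assume "bad S C" "C = {y}"
  then have "nb y - S \<subseteq> {y}" "card (nb y - S) = r" unfolding bad_def by auto
  moreover have "y \<notin> nb y" using adj_irrefl by simp
  ultimately have "nb y - S = {}" by blast
  then show False using \<open>card (nb y - S) = r\<close> r_pos by (metis card.empty less_irrefl)
qed

text \<open>If \<open>x\<close> has a neighbour in \<open>C\<close> besides \<open>v\<close>, then
  \<open>C - {v}\<close> is swallowed by the bad component that \<open>x\<close> enters. Comparing
  degrees before and after forces \<open>v\<close> and its outer neighbours to be a clique joined to
  \<open>x\<close>, and this clique is all of \<open>C\<close>.\<close>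

lemma swap_dichotomy:
  assumes opt: "optimal S" and bad: "bad S C" and v: "v \<in> C" "connected_set (C - {v})"
    and x: "x \<in> S" "adj v x" and ne: "nb x \<inter> C \<noteq> {v}"
  shows "C \<subseteq> nb x" and "clique C"
proof -
  define S' where "S' = insert v (S - {x})"
  obtain C' where C': "bad S' C'" "x \<in> C'"
    using swap_optimal(2)[OF opt bad v(1) x S'_def] by blast
  have max: "max_set S" "max_set S'"
    using opt optimalD swap_optimal(1)[OF opt bad v(1) x S'_def] by blast+
  have CV: "C \<subseteq> V - S" using bad unfolding bad_def by auto
  have xv: "x \<noteq> v" using x v CV by auto
  have "v \<in> nb x \<inter> C" using x v adj_sym by auto
  then have "\<exists>u. u \<in> nb x \<inter> C \<and> u \<noteq> v" using ne by blast
  then obtain u where u: "u \<in> C" "u \<noteq> v" "adj x u" by auto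
  have "u \<notin> S'" using u CV unfolding S'_def by auto
  then have "u \<in> C'" using bad_step[OF C' u(3)] by blast
  moreover have "C - {v} \<subseteq> V - S'" using CV unfolding S'_def by auto
  ultimately have sub: "C - {v} \<subseteq> C'"
    using bad_absorbs[OF C'(1) v(2)] u by auto
  define Q where "Q = nb v - S"
  have Q: "Q \<subseteq> C - {v}" "card Q = r" "finite Q"
    using bad_outer_degree[OF bad v(1)] bad_step[OF bad v(1)] adj_irrefl
    unfolding Q_def by auto
  \<comment> \<open>Before and after the exchange \<open>q\<close> has outer degree
    \<open>r\<close>. It loses the outer neighbour \<open>v\<close>, so it must gain
    \<open>x\<close>.\<close>
  have Qx: "adj q x" if q: "q \<in> Q" for q
  proof (rule ccontr)
    assume "\<not> adj q x"
    moreover have "v \<in> nb q - S" using q adj_sym v CV unfolding Q_def by auto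
    ultimately have "nb q - S' = (nb q - S) - {v}" "v \<in> nb q - S" unfolding S'_def by auto
    moreover have "card (nb q - S') = r" "card (nb q - S) = r"
      using q Q sub bad_outer_degree[OF C'(1), of q] bad_outer_degree[OF bad, of q] by auto
    ultimately show False using r_pos by (metis card_Diff_singleton diff_less less_irrefl zero_less_one)
  qed
  \<comment> \<open>Exchange \<open>a\<close> instead of \<open>v\<close> for \<open>x\<close>: a
    vertex \<open>b\<close> not adjacent to \<open>a\<close> would keep its \<open>r\<close> outer
    neighbours and gain \<open>x\<close>.\<close>
  have clQ: "adj a b" if ab: "a \<in> Q" "b \<in> Q" "a \<noteq> b" for a b
  proof (rule ccontr)
    assume na: "\<not> adj a b"
    define S2 where "S2 = insert a (S - {x})"
    have "max_set S2"
      unfolding S2_def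
    proof (rule bad_swap_max_set[OF max(1) bad _ x(1)])
      show "a \<in> C" "adj a x" using ab Q Qx by auto
    qed
    moreover have "insert x (nb b - S) \<subseteq> nb b - S2"
      using na adj_sym[of b a] ab(2,3) Qx[of b] ab x unfolding S2_def by auto
    moreover have "card (insert x (nb b - S)) = Suc r"
      using bad_outer_degree[OF bad, of b] ab Q x by auto
    moreover have "b \<in> V" "b \<notin> S2" using ab Q CV unfolding S2_def by auto
    ultimately show False using outer_degree_contr[of S2 b "insert x (nb b - S)"] by simp
  qed
  have cl: "clique (insert v Q)"
    using clQ unfolding clique_def by (auto simp: Q_def adj_commute)
  \<comment> \<open>Every vertex of this clique has all its \<open>r\<close> outer neighbours inside
    it, so it is closed in \<open>C\<close>.\<close>
  have C_eq: "insert v Q = C"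
  proof (rule bad_closed_eq[OF bad])
    fix a assume a: "a \<in> insert v Q"
    have aC: "a \<in> C" using a v Q by auto
    have "insert v Q - {a} = nb a - S"
    proof (rule card_subset_eq)
      show "insert v Q - {a} \<subseteq> nb a - S" using cl a Q CV v unfolding clique_def by auto
      have "v \<notin> Q" using Q by auto
      then have "card (insert v Q - {a}) = r" using a Q by auto
      then show "card (insert v Q - {a}) = card (nb a - S)"
        using bad_outer_degree[OF bad aC] by simp
    qed simp
    then show "nb a - S \<subseteq> insert v Q" by auto
  qed (use v Q in auto)
  show "clique C" using cl unfolding C_eq .
  have "adj q x" if "q \<in> insert v Q" for q using that Qx x(2) by blast
  then show "C \<subseteq> nb x" unfolding C_eq using adj_commute by auto
qed

text \<open>By \<open>univ\<close> all vertices of \<open>C\<close> have the same \<open>p\<close>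
  neighbours \<open>T\<close> in \<open>S\<close>. Exchanging \<open>v\<close> with an
  \<open>x\<close> in \<open>T\<close> turns \<open>C\<close> into
  \<open>insert x (C - {v})\<close>, and \<open>swap_dichotomy\<close> applied there makes
  \<open>x\<close> adjacent to the rest of \<open>T\<close>. The clique \<open>C \<union> T\<close>
  then exhausts the degree bound.\<close>

lemma clique_component:
  assumes opt: "optimal S" and bad: "bad S C" and cl: "clique C" and r2: "2 \<le> r"
    and univ: "\<And>v x. v \<in> C \<Longrightarrow> x \<in> S \<Longrightarrow> adj v x \<Longrightarrow> C \<subseteq> nb x"
  shows "\<exists>K\<subseteq>V. clique K \<and> card K = p + r + 1 \<and> (\<forall>u\<in>K. nb u \<subseteq> K)"
proof -
  have max: "max_set S" using opt optimalD by blast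
  have CV: "C \<subseteq> V - S" "C \<noteq> {}" using bad unfolding bad_def by auto
  have finC: "finite C" using CV finite_V finite_subset by blast
  have SV: "S \<subseteq> V" using max max_set_subset by blast
  obtain v where v: "v \<in> C" using CV by blast
  define T where "T = nb v \<inter> S"
  have T: "card T = p" "finite T" "T \<subseteq> S"
    using bad_inner_degree[OF max bad v] unfolding T_def by auto
  have adjT: "adj x c" "adj c x" if "x \<in> T" "c \<in> C" for x c
    using univ[OF v, of x] that adj_commute unfolding T_def by auto
  have C_eq: "nb u - S = C - {u}" if u: "u \<in> C" for u
    using bad_step[OF bad u] cl u CV adj_irrefl unfolding clique_def by auto
  have cardC: "card C = Suc r"
    using C_eq[OF v] bad_outer_degree[OF bad v] v finC r_pos by auto
  have T_eq: "nb u \<inter> S = T" if u: "u \<in> C" for u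
  proof -
    have "T \<subseteq> nb u \<inter> S" using adjT u T by auto
    then show ?thesis
      using card_subset_eq[of "nb u \<inter> S" T] bad_inner_degree[OF max bad u] T by auto
  qed
  have "adj x' x" if xx: "x \<in> T" "x' \<in> T" "x \<noteq> x'" for x x'
  proof -
    define S' where "S' = insert v (S - {x})"
    have vx: "x \<in> S" "adj v x" using xx unfolding T_def by auto
    obtain C' where C': "bad S' C'" "x \<in> C'"
      using swap_optimal(2)[OF opt bad v vx S'_def] by blast
    have max': "max_set S'" "optimal S'"
      using swap_optimal(1)[OF opt bad v vx S'_def] optimalD by auto
    have sub: "C - {v} \<subseteq> nb x - S'" using adjT xx CV unfolding S'_def by auto
    have "card (C - {v}) = r" using cardC v finC by simp
    then have nx: "nb x - S' = C - {v}"
      using sub bad_outer_degree[OF C'] card_subset_eq[of "nb x - S'" "C - {v}"] by simp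
    have "insert x (C - {v}) = C'"
    proof (rule bad_closed_eq[OF C'(1)])
      have "C - {v} \<subseteq> C'" unfolding nx[symmetric] using bad_step[OF C'] by auto
      then show "insert x (C - {v}) \<subseteq> C'" using C'(2) by simp
      fix a assume a: "a \<in> insert x (C - {v})"
      show "nb a - S' \<subseteq> insert x (C - {v})"
      proof (cases "a = x")
        case False
        then have "nb a - S = C - {a}" using C_eq a by auto
        then show ?thesis unfolding S'_def by auto
      qed (use nx in auto)
    qed simp
    moreover have "clique (insert x (C - {v}))"
      using cl adjT xx unfolding clique_def by auto
    ultimately have cl': "clique C'" by simp
    \<comment> \<open>\<open>2 \<le> r\<close> gives two vertices besides \<open>v\<close>, so
      \<open>x'\<close> has the second neighbour in \<open>C'\<close> that
      \<open>swap_dichotomy\<close> asks for.\<close>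
    have "\<not> card (C - {v}) \<le> 1" using cardC v finC r2 by simp
    then obtain w w' where w: "w \<in> C - {v}" "w' \<in> C - {v}" "w \<noteq> w'"
      using finC by (metis card_le_Suc0_iff_eq finite_Diff One_nat_def)
    have "C' \<subseteq> nb x'"
    proof (rule swap_dichotomy(1)[OF max'(2) C'(1)])
      show "w \<in> C'" using w \<open>insert x (C - {v}) = C'\<close> by auto
      show "connected_set (C' - {w})"
        using cl' clique_subset connected_set_clique by blast
      show "x' \<in> S'" using xx T unfolding S'_def by auto
      show "adj w x'" using adjT xx w by auto
      have "w' \<in> nb x' \<inter> C'" using w adjT xx \<open>insert x (C - {v}) = C'\<close> by auto
      then show "nb x' \<inter> C' \<noteq> {w}" using w by (metis singletonD)
    qed
    then show ?thesis using C' by auto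
  qed
  then have clK: "clique (C \<union> T)" using cl adjT unfolding clique_def by auto
  have cardK: "card (C \<union> T) = p + r + 1"
    using cardC T finC CV by (subst card_Un_disjoint) auto
  have "nb u \<subseteq> C \<union> T" if u: "u \<in> C \<union> T" for u
  proof -
    have sub: "C \<union> T - {u} \<subseteq> nb u"
    proof
      fix a assume "a \<in> C \<union> T - {u}"
      then show "a \<in> nb u" using clK u unfolding clique_def in_nb by (metis DiffD1 DiffD2 singletonI)
    qed
    have "card (nb u) \<le> p + r" using degree_le[of u] u CV T SV by blast
    moreover have "card (C \<union> T - {u}) = p + r" using cardK u finC T by simp
    ultimately have "C \<union> T - {u} = nb u"
      using sub by (intro card_seteq) auto
    then show ?thesis by auto
  qed
  moreover have "C \<union> T \<subseteq> V" using CV T SV by auto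
  ultimately show ?thesis using clK cardK by blast
qed

text \<open>Suppose every candidate fails. A non-cut vertex other than \<open>y\<close> shows that
  \<open>C\<close> is a clique; then all its vertices are non-cut, \<open>clique_component\<close>
  applies, and its closed clique is all of \<open>V\<close>.\<close>

lemma ex_good_swap:
  assumes opt: "optimal S" and bad: "bad S C" and y: "y \<in> C" and r2: "2 \<le> r"
    and conn: "connected_set V" and ncl: "\<not> (clique V \<and> card V = p + r + 1)"
  obtains v x where "v \<in> C" "v \<noteq> y" "connected_set (C - {v})" "x \<in> S" "adj v x" "nb x \<inter> C = {v}"
proof (rule ccontr)
  assume nt: "\<not> thesis"
  note found = that
  have none: "nb x \<inter> C \<noteq> {v}"
    if "v \<in> C" "v \<noteq> y" "connected_set (C - {v})" "x \<in> S" "adj v x" for v x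
    using found[OF that] nt by blast
  have max: "max_set S" using opt optimalD by blast
  have finC: "finite C" using bad_subset[OF bad] finite_V finite_subset by blast
  obtain v where v: "v \<in> C" "v \<noteq> y" "connected_set (C - {v})"
    using ex_non_cut_vertex[OF _ finC y bad_not_singleton[OF bad]] bad unfolding bad_def by blast
  have "card (nb v \<inter> S) = p" using bad_inner_degree[OF max bad v(1)] .
  then have "nb v \<inter> S \<noteq> {}" using p_pos by auto
  then obtain x where "x \<in> S" "adj v x" by auto
  then have cl: "clique C" using swap_dichotomy(2)[OF opt bad v(1,3)] none v by blast
  have conn': "connected_set (C - {u})" for u
    using cl clique_subset connected_set_clique by blast
  have univ: "C \<subseteq> nb x" if x: "x \<in> S" "adj u x" "u \<in> C" for x u
  proof (cases "u = y \<and> nb x \<inter> C = {y}")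
    case False
    then have "nb x \<inter> C \<noteq> {u}" using none[of u x] x conn' by blast
    then show ?thesis using swap_dichotomy(1)[OF opt bad] x conn' by blast
  next
    case True
    \<comment> \<open>Here \<open>y\<close> may not be exchanged, so count: the \<open>p\<close>
      neighbours of \<open>v\<close> in \<open>S\<close> are adjacent to all of \<open>C\<close>,
      hence to \<open>y\<close>, and \<open>x\<close> is none of them. So \<open>y\<close> would
      have more than \<open>p\<close> neighbours in \<open>S\<close>.\<close>
    have "nb v \<inter> S \<subseteq> nb y \<inter> S - {x}"
    proof
      fix z assume z: "z \<in> nb v \<inter> S"
      then have "C \<subseteq> nb z" using swap_dichotomy(1)[OF opt bad v(1,3), of z] none[OF v, of z] by auto
      moreover have "\<not> C \<subseteq> nb x" using True v by blast
      ultimately show "z \<in> nb y \<inter> S - {x}" using z y adj_commute by auto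
    qed
    then have "card (nb v \<inter> S) \<le> card (nb y \<inter> S - {x})" by (simp add: card_mono)
    also have "\<dots> < card (nb y \<inter> S)" using x True by (intro card_Diff1_less) auto
    finally show ?thesis using bad_inner_degree[OF max bad] v y by simp
  qed
  obtain K where K: "K \<subseteq> V" "clique K" "card K = p + r + 1" "\<forall>u\<in>K. nb u \<subseteq> K"
    using clique_component[OF opt bad cl r2] univ by blast
  then have "K \<noteq> {}" by auto
  then have "K = V" using connected_set_closed_eq[OF conn K(1)] K(4) by blast
  then show False using K ncl by simp
qed

section \<open>Iterated exchanges and their disjoint remainders\<close>

text \<open>
  A site is what a swap leaves behind of a bad component: the removed vertex \<open>v\<close> is still in \<open>S\<close>, and
  its further neighbour in \<open>W - L\<close> prevents it from ever leaving \<open>S\<close> again.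
\<close>

definition site :: "'a set \<Rightarrow> 'a set \<Rightarrow> 'a set \<Rightarrow> bool" where
  "site S W L \<longleftrightarrow> L \<noteq> {} \<and> L \<subseteq> V - S \<and> connected_set L \<and> (\<forall>u\<in>L. nb u - S \<subseteq> L) \<and>
     (\<exists>v\<in>S. card (nb v \<inter> L) = r \<and> (\<forall>u\<in>nb v \<inter> L. Suc (card (nb u - S)) = r) \<and>
       (\<exists>z\<in>W - L. z \<notin> S \<and> adj v z))"

text \<open>\<open>y\<close> is the vertex that entered \<open>C\<close> last, arbitrary at the
  start. The further neighbour required by a new site is \<open>y\<close> itself, which the next
  exchange makes part of a remainder; hence the set \<open>insert y (\<Union>\<L>)\<close>.\<close>

definition walk_state :: "'a set \<Rightarrow> 'a set \<Rightarrow> 'a \<Rightarrow> 'a set set \<Rightarrow> bool" where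
  "walk_state S C y \<L> \<longleftrightarrow> optimal S \<and> bad S C \<and> y \<in> C \<and>
     (\<forall>L\<in>\<L>. site S (insert y (\<Union>\<L>)) L \<and> L \<inter> C = {})"

text \<open>Exchange the pair from \<open>ex_good_swap\<close> and record \<open>C - {v}\<close> as
  a new site. Earlier sites survive because \<open>x\<close> is none of the vertices they keep in
  \<open>S\<close> (\<open>stay\<close>) and has no neighbour in their remainders
  (\<open>no_return\<close>).\<close>

lemma walk_step:
  assumes st: "walk_state S C y \<L>" and r2: "2 \<le> r"
    and conn: "connected_set V" and ncl: "\<not> (clique V \<and> card V = p + r + 1)"
  shows "\<exists>S' C' y' \<L>'. walk_state S' C' y' \<L>' \<and> \<Union>\<L> \<subset> \<Union>\<L>'"
proof -
  have opt: "optimal S" and bad: "bad S C" and y: "y \<in> C"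
    and sites: "\<And>L. L \<in> \<L> \<Longrightarrow> site S (insert y (\<Union>\<L>)) L"
    and disj: "\<And>L. L \<in> \<L> \<Longrightarrow> L \<inter> C = {}"
    using st unfolding walk_state_def by auto
  obtain v x where v: "v \<in> C" "v \<noteq> y" "connected_set (C - {v})"
    and x: "x \<in> S" "adj v x" "nb x \<inter> C = {v}"
    using ex_good_swap[OF opt bad y r2 conn ncl] by blast
  define S' where "S' = insert v (S - {x})"
  have opt': "optimal S'" using swap_optimal(1)[OF opt bad v(1) x(1,2) S'_def] .
  obtain C' where C': "bad S' C'" "x \<in> C'"
    using swap_optimal(2)[OF opt bad v(1) x(1,2) S'_def] by blast
  have max: "max_set S" "max_set S'" using opt opt' optimalD by auto
  have CV: "C \<subseteq> V - S" "C' \<subseteq> V - S'" using bad C' bad_subset by auto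
  have SV: "S \<subseteq> V" using max max_set_subset by blast
  have xC: "x \<notin> C" "x \<noteq> v" using x CV v by auto
  define L0 where "L0 = C - {v}"
  have L0: "L0 \<noteq> {}" "y \<in> L0" using v y unfolding L0_def by auto
  have LC: "L \<subseteq> V - S" "L \<subseteq> V - S'" "x \<notin> L" "v \<notin> L" if "L \<in> \<L>" for L
    using sites[OF that] disj[OF that] v x unfolding site_def S'_def by auto
  \<comment> \<open>Outside \<open>S'\<close>, such an \<open>x\<close> would have \<open>r\<close>
    neighbours in \<open>L\<close> and the further neighbour \<open>z\<close>.\<close>
  have stay: "v' \<noteq> x"
    if L: "L \<in> \<L>" and v': "v' \<in> S" "card (nb v' \<inter> L) = r" "z \<in> insert y (\<Union>\<L>) - L" "adj v' z" for L v' z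
  proof
    assume eq: "v' = x"
    have "z \<in> nb x - S'" using v' eq y v disj LC CV unfolding S'_def by auto
    then have "insert z (nb x \<inter> L) \<subseteq> nb x - S'" using LC[OF L] by auto
    moreover have "card (insert z (nb x \<inter> L)) = Suc r" using v' eq by auto
    moreover have "x \<in> V" "x \<notin> S'" using x SV xC unfolding S'_def by auto
    ultimately show False using outer_degree_contr[OF max(2), of x] by (metis lessI)
  qed
  \<comment> \<open>Otherwise the new bad component is exactly \<open>insert x L\<close>. One more
    exchange, of some \<open>a\<close> in \<open>Q\<close> for \<open>v'\<close>, then gives
    \<open>v'\<close> too many outer neighbours.\<close>
  have no_return: "nb x \<inter> L = {}" if L: "L \<in> \<L>" for L
  proof (rule ccontr)
    assume ne: "nb x \<inter> L \<noteq> {}"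
    obtain v' z where v': "v' \<in> S" "card (nb v' \<inter> L) = r"
        "\<And>u. u \<in> nb v' \<inter> L \<Longrightarrow> Suc (card (nb u - S)) = r"
        "z \<in> insert y (\<Union>\<L>) - L" "z \<notin> S" "adj v' z"
      using sites[OF L] unfolding site_def by blast
    define Q where "Q = nb v' \<inter> L"
    have Lcl: "nb u - S \<subseteq> L" if "u \<in> L" for u using sites[OF L] that unfolding site_def by blast
    have L_C': "L \<subseteq> C'"
    proof (rule bad_absorbs[OF C'(1)])
      show "connected_set L" using sites[OF L] unfolding site_def by blast
      show "L \<subseteq> V - S'" using LC[OF L] by blast
      obtain a where "a \<in> L" "adj x a" using ne by auto
      then have "a \<in> C'" using bad_step[OF C'] LC[OF L] by auto
      then show "L \<inter> C' \<noteq> {}" using \<open>a \<in> L\<close> by auto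
    qed
    \<comment> \<open>\<open>q\<close> had outer degree \<open>r - 1\<close> for \<open>S\<close>;
      in a bad component of \<open>S'\<close> it has \<open>r\<close>, so it gained
      \<open>x\<close>.\<close>
    have Q_adj: "adj x q" if q: "q \<in> Q" for q
    proof (rule ccontr)
      assume "\<not> adj x q"
      then have "nb q - S' \<subseteq> nb q - S" using adj_commute unfolding S'_def by auto
      then have "card (nb q - S') \<le> card (nb q - S)" by (simp add: card_mono)
      moreover have "card (nb q - S') = r"
        using bad_outer_degree[OF C'(1)] L_C' q unfolding Q_def by auto
      ultimately show False using v'(3)[of q] q unfolding Q_def by auto
    qed
    have Q: "Q = nb x - S'"
    proof (rule card_subset_eq)
      show "Q \<subseteq> nb x - S'" using Q_adj LC[OF L] unfolding Q_def by auto
      show "card Q = card (nb x - S')" using v' bad_outer_degree[OF C'] unfolding Q_def by simp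
    qed simp
    have C'_eq: "insert x L = C'"
    proof (rule bad_closed_eq[OF C'(1)])
      fix a assume a: "a \<in> insert x L"
      show "nb a - S' \<subseteq> insert x L"
      proof (cases "a = x")
        case True
        then show ?thesis using Q unfolding Q_def by auto
      next
        case False
        then show ?thesis using Lcl[of a] a unfolding S'_def by auto
      qed
    qed (use L_C' C' in auto)
    have v'S': "v' \<in> S'" using stay[OF L v'(1,2,4,6)] v'(1) unfolding S'_def by auto
    have zS': "z \<notin> S'" "z \<notin> C'"
      using v' y v disj LC CV x C'_eq unfolding S'_def by auto
    \<comment> \<open>\<open>2 \<le> r\<close> supplies a second vertex \<open>b\<close> of
      \<open>Q\<close>, which still links \<open>v'\<close> to \<open>x\<close> after
      \<open>a\<close> has been moved.\<close>
    have "Suc 0 < card Q" using v' r2 unfolding Q_def by simp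
    then obtain a b where ab: "a \<in> Q" "b \<in> Q" "a \<noteq> b"
      by (metis card_le_Suc0_iff_eq card.infinite not_less zero_le)
    have va: "adj v' a" "adj v' b" "a \<in> C'" "b \<in> C'" using ab L_C' unfolding Q_def by auto
    define S2 where "S2 = insert a (S' - {v'})"
    have av: "adj a v'" using va adj_commute by blast
    obtain C2 where C2: "bad S2 C2" "v' \<in> C2"
      using swap_optimal(2)[OF opt' C'(1) va(3) v'S' av S2_def] by blast
    have max2: "max_set S2"
      using swap_optimal(1)[OF opt' C'(1) va(3) v'S' av S2_def] optimalD by blast
    have aL: "a \<in> L" "b \<in> L" using ab unfolding Q_def by auto
    have out: "b \<notin> S2" "x \<notin> S2" "z \<notin> S2" "v' \<notin> S2" "v' \<noteq> x" "v' \<noteq> a"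
      using va ab aL CV LC[OF L] zS' C' v'S' unfolding S2_def S'_def by auto
    have "b \<in> C2" using bad_step[OF C2 va(2)] out by blast
    then have "x \<in> C2" using bad_step[OF C2(1), of b x] Q_adj[OF ab(2)] out adj_commute by blast
    then have deg: "card (nb x - S2) = r" using bad_outer_degree[OF C2(1)] by blast
    \<comment> \<open>\<open>x\<close> lost its outer neighbour \<open>a\<close> and still has outer
      degree \<open>r\<close>; only \<open>v'\<close> can have replaced it.\<close>
    have "adj x v'"
    proof (rule ccontr)
      assume "\<not> adj x v'"
      then have "nb x - S2 = Q - {a}" using Q out unfolding S2_def by auto
      then have "card (nb x - S2) < r" using ab v' r_pos unfolding Q_def by simp
      then show False using deg by simp
    qed
    then have "insert z (insert x (Q - {a})) \<subseteq> nb v' - S2"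
      using v' out adj_commute Q unfolding S2_def by (auto simp: Q_def)
    moreover have "z \<noteq> x" "z \<notin> L" "x \<notin> L" using zS' C' LC[OF L] v' by auto
    then have "card (insert z (insert x (Q - {a}))) = Suc r"
      using ab v' r_pos unfolding Q_def by auto
    moreover have "v' \<in> V" using v' SV by auto
    ultimately show False using outer_degree_contr[OF max2 _ out(4)] by (metis lessI)
  qed
  \<comment> \<open>An earlier remainder touches neither \<open>x\<close>, by
    \<open>no_return\<close>, nor \<open>v\<close>, since it is disjoint from the component
    \<open>C\<close>.\<close>
  have keep: "nb u - S' = nb u - S" if "u \<in> L" "L \<in> \<L>" for u L
  proof -
    have "u \<notin> nb x" using no_return[OF that(2)] that(1) by blast
    then have "\<not> adj u x" using adj_commute by simp
    moreover have "\<not> adj u v"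
      using bad_step[OF bad v(1), of u] adj_commute disj[OF that(2)] LC(1)[OF that(2)] that(1) by auto
    ultimately show ?thesis unfolding S'_def by auto
  qed
  define W where "W = insert x (\<Union>(insert L0 \<L>))"
  have site_L: "site S' W L" if L: "L \<in> \<L>" for L
  proof -
    obtain v' z where v': "v' \<in> S" "card (nb v' \<inter> L) = r"
        "\<And>u. u \<in> nb v' \<inter> L \<Longrightarrow> Suc (card (nb u - S)) = r"
        "z \<in> insert y (\<Union>\<L>) - L" "z \<notin> S" "adj v' z"
      using sites[OF L] unfolding site_def by blast
    have "v' \<in> S'" using stay[OF L v'(1,2,4,6)] v'(1) unfolding S'_def by auto
    moreover have "z \<in> W - L" using v' L0 unfolding W_def by auto
    moreover have "z \<notin> S'" using v' v disj y unfolding S'_def by auto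
    moreover have "\<forall>u\<in>nb v' \<inter> L. Suc (card (nb u - S')) = r" using v'(3) keep[OF _ L] by simp
    ultimately have "\<exists>v\<in>S'. card (nb v \<inter> L) = r \<and> (\<forall>u\<in>nb v \<inter> L. Suc (card (nb u - S')) = r) \<and>
       (\<exists>z\<in>W - L. z \<notin> S' \<and> adj v z)" using v'(2,6) by blast
    then show ?thesis using sites[OF L] LC[OF L] keep[OF _ L] unfolding site_def by simp
  qed
  \<comment> \<open>As \<open>v\<close> is the only neighbour of \<open>x\<close> in
    \<open>C\<close>, no vertex of \<open>L0\<close> gains \<open>x\<close>.\<close>
  have nbL0: "nb u - S' = nb u - S - {v}" if "u \<in> L0" for u
  proof -
    have "\<not> adj u x" using that x(3) adj_commute unfolding L0_def by auto
    then show ?thesis unfolding S'_def by auto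
  qed
  \<comment> \<open>\<open>v\<close> is the vertex now kept in \<open>S'\<close>: its
    \<open>r\<close> outer neighbours lie in \<open>L0\<close>, each has just lost \<open>v\<close>,
    and \<open>x\<close> is the further neighbour.\<close>
  have site_L0: "site S' W L0"
  proof -
    have *: "nb v \<inter> L0 = nb v - S"
      using bad_step[OF bad v(1)] CV adj_irrefl unfolding L0_def by auto
    have "card (nb v \<inter> L0) = r" using bad_outer_degree[OF bad v(1)] * by simp
    moreover have "Suc (card (nb u - S')) = r" if u: "u \<in> nb v \<inter> L0" for u
    proof -
      have "v \<in> nb u - S" using u v CV adj_commute by auto
      then have "Suc (card (nb u - S - {v})) = card (nb u - S)"
        by (intro card_Suc_Diff1) auto
      also have "\<dots> = r" using bad_outer_degree[OF bad] u unfolding L0_def by auto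
      finally show ?thesis using nbL0 u by simp
    qed
    moreover have "x \<in> W - L0" "x \<notin> S'" "adj v x" "v \<in> S'"
      using xC x unfolding W_def L0_def S'_def by auto
    ultimately have "\<exists>v\<in>S'. card (nb v \<inter> L0) = r \<and> (\<forall>u\<in>nb v \<inter> L0. Suc (card (nb u - S')) = r) \<and>
       (\<exists>z\<in>W - L0. z \<notin> S' \<and> adj v z)" by blast
    moreover have "L0 \<subseteq> V - S'" using CV unfolding L0_def S'_def by auto
    moreover have "nb u - S' \<subseteq> L0" if u: "u \<in> L0" for u
      using nbL0[OF u] bad_step[OF bad, of u] u unfolding L0_def by auto
    ultimately show ?thesis using L0 v(3) unfolding site_def L0_def[symmetric] by auto
  qed
  \<comment> \<open>A remainder meeting \<open>C'\<close> is closed under outer neighbours and would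
    contain all of \<open>C'\<close>, including \<open>x\<close>.\<close>
  have site_disj: "L \<inter> C' = {}" if "site S' W L" "nb x \<inter> L = {}" "x \<notin> L" for L
  proof (rule ccontr)
    assume ne: "L \<inter> C' \<noteq> {}"
    have "L \<inter> C' = C'"
    proof (rule bad_closed_eq[OF C'(1) _ ne])
      show "nb a - S' \<subseteq> L \<inter> C'" if "a \<in> L \<inter> C'" for a
        using \<open>site S' W L\<close> bad_step[OF C'(1), of a] that unfolding site_def by auto
    qed auto
    then show False using C' that by auto
  qed
  have "nb x \<inter> L0 = {}" using x unfolding L0_def by auto
  then have "L0 \<inter> C' = {}" using site_disj[OF site_L0] xC unfolding L0_def by auto
  moreover have "L \<inter> C' = {}" if "L \<in> \<L>" for L
    using site_disj[OF site_L[OF that] no_return[OF that]] LC[OF that] by auto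
  ultimately have "walk_state S' C' x (insert L0 \<L>)"
    using opt' C' site_L site_L0 unfolding walk_state_def W_def by auto
  moreover have "\<Union>\<L> \<subset> \<Union>(insert L0 \<L>)"
  proof -
    \<comment> \<open>The union grows by \<open>y\<close> at least, which is in \<open>L0\<close>
      because \<open>v \<noteq> y\<close>.\<close>
    have "y \<notin> \<Union>\<L>" using disj y by auto
    then show ?thesis using L0 by auto
  qed
  ultimately show ?thesis by blast
qed

text \<open>Otherwise the walk never stops, although each step strictly enlarges a subset of the
  finite set \<open>V\<close>.\<close>

theorem ex_max_set_no_bad:
  assumes r2: "2 \<le> r" and conn: "connected_set V" and ncl: "\<not> (clique V \<and> card V = p + r + 1)"
  shows "\<exists>S. max_set S \<and> (\<forall>C. \<not> bad S C)"
proof (rule ccontr)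
  assume no: "\<not> ?thesis"
  obtain S where S: "optimal S" using ex_optimal by blast
  then obtain C where C: "bad S C" using no optimalD by blast
  then obtain y where "y \<in> C" unfolding bad_def by auto
  then have init: "walk_state S C y {}" using S C unfolding walk_state_def by simp
  have bound: "\<Union>\<L> \<subseteq> V" if "walk_state S C y \<L>" for S C y \<L>
  proof -
    have "site S (insert y (\<Union>\<L>)) L" if "L \<in> \<L>" for L
      using \<open>walk_state S C y \<L>\<close> that unfolding walk_state_def by simp
    then have "L \<subseteq> V" if "L \<in> \<L>" for L
      using that unfolding site_def by (meson Diff_subset subset_trans)
    then show ?thesis by blast
  qed
  have long: "\<exists>S C y \<L>. walk_state S C y \<L> \<and> n \<le> card (\<Union>\<L>)" for n
  proof (induction n)
    case 0
    then show ?case using init by blast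
  next
    case (Suc n)
    then obtain S C y \<L> where st: "walk_state S C y \<L>" "n \<le> card (\<Union>\<L>)" by blast
    obtain S' C' y' \<L>' where st': "walk_state S' C' y' \<L>'" "\<Union>\<L> \<subset> \<Union>\<L>'"
      using walk_step[OF st(1) assms] by blast
    have "card (\<Union>\<L>) < card (\<Union>\<L>')"
      using psubset_card_mono[OF finite_subset[OF bound[OF st'(1)] finite_V] st'(2)] .
    then have "Suc n \<le> card (\<Union>\<L>')" using st(2) by simp
    then show ?case using st'(1) by blast
  qed
  obtain S C y \<L> where st: "walk_state S C y \<L>" "Suc (card V) \<le> card (\<Union>\<L>)"
    using long[of "Suc (card V)"] by blast
  then show False using card_mono[OF finite_V bound[OF st(1)]] by simp
qed

section \<open>Degeneracy outside the maximum set, and the case of degree two\<close>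

text \<open>A minimal nonempty set \<open>C\<close> outside \<open>S\<close> with all inner degrees
  at least \<open>r\<close> would be bad: outer degrees are at most \<open>r\<close>, so no outer
  neighbour is missing from \<open>C\<close>, and a proper part without edges to the rest would be a
  smaller such set.\<close>

lemma no_bad_degenerate:
  assumes max: "max_set S" and none: "\<And>C. \<not> bad S C" and W: "W \<subseteq> V - S" "W \<noteq> {}"
  shows "\<exists>u\<in>W. card (nb u \<inter> W) < r"
proof (rule ccontr)
  assume no: "\<not> ?thesis"
  define \<W> where "\<W> = {W. W \<subseteq> V - S \<and> W \<noteq> {} \<and> (\<forall>u\<in>W. r \<le> card (nb u \<inter> W))}"
  have "finite \<W>"
    by (rule finite_subset[of _ "Pow V"]) (auto simp: \<W>_def finite_V)
  moreover have "W \<in> \<W>" using no W unfolding \<W>_def by auto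
  ultimately obtain C where C: "C \<in> \<W>" and mn: "\<And>B. B \<in> \<W> \<Longrightarrow> B \<subseteq> C \<Longrightarrow> C = B"
    using finite_has_minimal[of \<W>] by (metis empty_iff)
  have CV: "C \<subseteq> V - S" "C \<noteq> {}" "\<And>u. u \<in> C \<Longrightarrow> r \<le> card (nb u \<inter> C)"
    using C unfolding \<W>_def by auto
  have eq: "nb u \<inter> C = nb u - S" if u: "u \<in> C" for u
  proof (rule card_seteq)
    show "nb u \<inter> C \<subseteq> nb u - S" using CV by auto
    have "card (nb u - S) \<le> r" using outer_degree_le[OF max, of u] CV u by auto
    then show "card (nb u - S) \<le> card (nb u \<inter> C)" using CV(3)[OF u] by simp
  qed simp
  have "connected_set C"
    unfolding connected_set_def
  proof (intro allI impI, rule ccontr)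
    fix B assume B: "B \<subseteq> C" "B \<noteq> {}" "B \<noteq> C" and nadj: "\<not> (\<exists>u\<in>B. \<exists>w\<in>C - B. adj u w)"
    have "nb u \<inter> B = nb u \<inter> C" if "u \<in> B" for u
      using that B(1) nadj by (auto simp del: Diff_iff) blast
    then have "\<forall>u\<in>B. r \<le> card (nb u \<inter> B)" using CV(3) B(1) by (metis subsetD)
    then have "B \<in> \<W>" using B(1,2) CV(1) unfolding \<W>_def by blast
    then show False using mn B(1,3) by blast
  qed
  moreover have "nb u - S \<subseteq> C \<and> card (nb u - S) = r" if u: "u \<in> C" for u
    using eq[OF u] CV(3)[OF u] outer_degree_le[OF max, of u] CV u by auto
  ultimately have "bad S C" using CV(1,2) unfolding bad_def by simp
  then show False using none by blast
qed

text \<open>The assumption \<open>pair\<close> says that \<open>K\<^sub>2\<close> is not forbidden.\<close>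

lemma ex_max_set_no_bad_degree_two:
  assumes pr: "p = 1" "r = 1"
    and pair: "\<And>A v x. A \<subseteq> V \<Longrightarrow> v \<in> V \<Longrightarrow> P A \<Longrightarrow> nb v \<inter> A = {x} \<Longrightarrow> nb x \<inter> A = {} \<Longrightarrow> P (insert v A)"
  shows "\<exists>S. max_set S \<and> (\<forall>C. \<not> bad S C)"
proof (rule ccontr)
  assume no: "\<not> ?thesis"
  obtain S where opt: "optimal S" using ex_optimal by blast
  then have max: "max_set S" using optimalD by blast
  then obtain C where bad: "bad S C" using no by blast
  then obtain v where v: "v \<in> C" unfolding bad_def by auto
  have vV: "v \<in> V" "v \<notin> S" using bad_subset[OF bad] v by auto
  have SV: "S \<subseteq> V" "P S" using max unfolding max_set_def by auto
  have "card (nb v \<inter> S) = 1" using bad_inner_degree[OF max bad v] pr by simp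
  then obtain x where x: "nb v \<inter> S = {x}" using card_1_singletonE by blast
  have xS: "x \<in> S" "adj v x" using x by auto
  \<comment> \<open>If \<open>x\<close> were isolated in \<open>S\<close>, adding \<open>v\<close>
    would only create an isolated edge, which \<open>pair\<close> permits.\<close>
  have "nb x \<inter> S \<noteq> {}"
  proof
    assume "nb x \<inter> S = {}"
    then have "P (insert v S)" using pair[OF SV(1) vV(1) SV(2) x] by blast
    moreover have "card (insert v S) = Suc (card S)"
      using vV SV finite_V finite_subset by (metis card_insert_disjoint)
    moreover have "insert v S \<subseteq> V" using vV SV by auto
    ultimately show False using max unfolding max_set_def by (metis Suc_n_not_le_n)
  qed
  then obtain z where z: "z \<in> S" "adj x z" by auto
  define S' where "S' = insert v (S - {x})"
  obtain C' where C': "bad S' C'" "x \<in> C'"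
    using swap_optimal(2)[OF opt bad v xS S'_def] by blast
  \<comment> \<open>\<open>x\<close> now lies in a bad component, so it has only
    \<open>p = 1\<close> neighbour in \<open>S'\<close>; but both \<open>v\<close> and
    \<open>z\<close> are there.\<close>
  have "card (nb x \<inter> S') = 1"
    using bad_inner_degree[OF _ C'] swap_optimal(1)[OF opt bad v xS S'_def] optimalD pr by auto
  moreover have "{v, z} \<subseteq> nb x \<inter> S'" using z xS adj_irrefl adj_commute unfolding S'_def by auto
  then have "card {v, z} \<le> card (nb x \<inter> S')" by (intro card_mono) auto
  moreover have "v \<noteq> z" using z vV by auto
  ultimately show False by simp
qed

end

subsection \<open>Graphs and families of forbidden subgraphs\<close>

sublocale graph \<subseteq> sg: finite_sgraph "verts G" "\<lambda>u v. (u, v) \<in> arcs_ends G"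
proof
  show "(u, v) \<in> arcs_ends G \<Longrightarrow> v \<in> verts G" for u v using adj_in_verts by blast
  show "(u, v) \<in> arcs_ends G \<Longrightarrow> (v, u) \<in> arcs_ends G" for u v using graph_symmetric by blast
  show "(u, u) \<notin> arcs_ends G" for u using adj_not_same by blast
qed simp

text \<open>Stated for well-formed digraphs, with arcs in either direction, so that it also applies
  to copies whose symmetry has not been established.\<close>

lemma (in wf_digraph) connected_closed_eq:
  assumes conn: "Digraph_Component.connected G" and A: "A \<subseteq> verts G" "A \<noteq> {}"
    and closed: "\<And>a b. a \<in> A \<Longrightarrow> (a, b) \<in> arcs_ends G \<or> (b, a) \<in> arcs_ends G \<Longrightarrow> b \<in> A"
  shows "A = verts G"
proof -
  interpret S: pair_wf_digraph "mk_symmetric G" ..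
  obtain a where a: "a \<in> A" using A by blast
  have "b \<in> A" if b: "b \<in> verts G" for b
  proof -
    have "a \<rightarrow>\<^sup>*\<^bsub>with_proj (mk_symmetric G)\<^esub> b"
      using conn a b A unfolding Digraph_Component.connected_def strongly_connected_def by auto
    then show ?thesis
    proof (induction rule: S.reachable_induct)
      case base
      then show ?case using a by simp
    next
      case (step x y)
      then have "(x, y) \<in> arcs_ends G \<or> (y, x) \<in> arcs_ends G"
        unfolding with_proj_simps parcs_mk_symmetric arcs_ends_conv by auto
      then show ?case using closed step by blast
    qed
  qed
  then show ?thesis using A by blast
qed

text \<open>Without parallel arcs an arc is determined by its ends, so the vertex bijection
  determines the arc map.\<close>

lemma digraph_iso_bijI:
  assumes F: "nomulti_digraph F" and G: "nomulti_digraph G" and bij: "bij_betw f (verts F) (verts G)"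
    and ends: "\<And>u v. u \<in> verts F \<Longrightarrow> v \<in> verts F \<Longrightarrow> (u, v) \<in> arcs_ends F \<longleftrightarrow> (f u, f v) \<in> arcs_ends G"
  shows "digraph_iso F G"
proof -
  interpret F: nomulti_digraph F by fact
  interpret G: nomulti_digraph G by fact
  define \<phi> where "\<phi> = (\<lambda>a. the_inv_into (arcs G) (arc_to_ends G) (f (tail F a), f (head F a)))"
  \<comment> \<open>\<open>digraph_iso\<close> asks for equality with \<open>app_iso hom F\<close>,
    so head and tail are taken from \<open>G\<close> itself.\<close>
  define hom where "hom = \<lparr>iso_verts = f, iso_arcs = \<phi>, iso_head = head G, iso_tail = tail G\<rparr>"
  have \<phi>: "\<phi> a \<in> arcs G \<and> tail G (\<phi> a) = f (tail F a) \<and> head G (\<phi> a) = f (head F a)"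
    if a: "a \<in> arcs F" for a
  proof -
    have "(tail F a, head F a) \<in> arcs_ends F" using a unfolding arcs_ends_conv by auto
    then have "(f (tail F a), f (head F a)) \<in> arcs_ends G" using ends a by simp
    then have img: "(f (tail F a), f (head F a)) \<in> arc_to_ends G ` arcs G" unfolding arcs_ends_def .
    have "\<phi> a \<in> arcs G" unfolding \<phi>_def
      using the_inv_into_into[OF G.inj_on_arc_to_ends img subset_refl] .
    moreover have "arc_to_ends G (\<phi> a) = (f (tail F a), f (head F a))" unfolding \<phi>_def
      using f_the_inv_into_f[OF G.inj_on_arc_to_ends img] .
    ultimately show ?thesis unfolding arc_to_ends_def by simp
  qed
  have injf: "inj_on f (verts F)" "f ` verts F = verts G" using bij unfolding bij_betw_def by auto
  have inj\<phi>: "inj_on \<phi> (arcs F)"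
  proof (rule inj_onI)
    fix a b assume ab: "a \<in> arcs F" "b \<in> arcs F" "\<phi> a = \<phi> b"
    then have "f (tail F a) = f (tail F b)" "f (head F a) = f (head F b)" using \<phi> by metis+
    then have "tail F a = tail F b" "head F a = head F b" using injf(1) ab by (auto dest: inj_onD)
    then show "a = b" using F.no_multi_arcs ab unfolding arc_to_ends_def by simp
  qed
  have img: "\<phi> ` arcs F = arcs G"
  proof
    show "\<phi> ` arcs F \<subseteq> arcs G" using \<phi> by auto
    show "arcs G \<subseteq> \<phi> ` arcs F"
    proof
      fix e assume e: "e \<in> arcs G"
      then have "tail G e \<in> f ` verts F" "head G e \<in> f ` verts F" using injf by auto
      then obtain u v where uv: "u \<in> verts F" "v \<in> verts F" "tail G e = f u" "head G e = f v" by auto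
      then have "(f u, f v) \<in> arcs_ends G" using e unfolding arcs_ends_conv by force
      then have "(u, v) \<in> arcs_ends F" using ends uv by simp
      then obtain a where a: "a \<in> arcs F" "tail F a = u" "head F a = v" by auto
      then have "arc_to_ends G (\<phi> a) = arc_to_ends G e" using \<phi>[OF a(1)] uv unfolding arc_to_ends_def by simp
      then have "\<phi> a = e" using G.no_multi_arcs e \<phi>[OF a(1)] by blast
      then show "e \<in> \<phi> ` arcs F" using a by blast
    qed
  qed
  have "pre_digraph.digraph_isomorphism F hom"
    unfolding pre_digraph.digraph_isomorphism_def hom_def
    using injf inj\<phi> \<phi> F.wf_digraph by auto
  moreover have "G = app_iso hom F"
    unfolding app_iso_def hom_def using injf img by (intro pre_digraph.equality) auto
  ultimately show ?thesis unfolding digraph_iso_def by blast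
qed

lemma complete_digraph_iso:
  assumes F: "complete_digraph n F" and G: "complete_digraph n G"
  shows "digraph_iso F G"
proof -
  interpret F: graph F using F unfolding complete_digraph_def by blast
  interpret G: graph G using G unfolding complete_digraph_def by blast
  have "card (verts F) = card (verts G)" using F G unfolding complete_digraph_def by simp
  then obtain f where f: "bij_betw f (verts F) (verts G)"
    using finite_same_card_bij F.finite_verts G.finite_verts by blast
  show ?thesis
  proof (rule digraph_iso_bijI[OF F.nomulti_digraph G.nomulti_digraph f])
    fix u v assume "u \<in> verts F" "v \<in> verts F"
    then show "(u, v) \<in> arcs_ends F \<longleftrightarrow> (f u, f v) \<in> arcs_ends G"
      using F G f unfolding complete_digraph_def bij_betw_def by (auto dest: inj_onD)
  qed
qed

context graph
begin

lemma out_degree_eq: "out_degree G u = card (sg.nb u)"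
proof -
  have "v \<in> sg.nb u \<longleftrightarrow> v \<in> head G ` out_arcs G u" for v
    unfolding sg.in_nb by (auto simp: arcs_ends_conv image_iff)
  then have "sg.nb u = head G ` out_arcs G u" by blast
  moreover have "inj_on (head G) (out_arcs G u)"
    by (rule inj_onI) (auto simp: arc_to_ends_def intro!: no_multi_arcs)
  ultimately show ?thesis unfolding out_degree_def by (simp add: card_image)
qed

lemma min_degree_le: "u \<in> verts G \<Longrightarrow> min_degree G \<le> out_degree G u"
  unfolding min_degree_def by simp

lemma out_degree_le_max: "u \<in> verts G \<Longrightarrow> out_degree G u \<le> max_degree G"
  unfolding max_degree_def by simp

lemma connected_set_verts:
  assumes "Digraph_Component.connected G"
  shows "sg.connected_set (verts G)"
  unfolding sg.connected_set_def
proof (intro allI impI, rule ccontr)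
  fix A assume A: "A \<subseteq> verts G" "A \<noteq> {}" "A \<noteq> verts G"
    and no: "\<not> (\<exists>u\<in>A. \<exists>w\<in>verts G - A. (u, w) \<in> arcs_ends G)"
  have "b \<in> A" if "a \<in> A" "(a, b) \<in> arcs_ends G \<or> (b, a) \<in> arcs_ends G" for a b
    using that no graph_symmetric adj_in_verts by blast
  then have "A = verts G" using connected_closed_eq[OF assms A(1,2)] by blast
  then show False using A by blast
qed

lemma complete_digraphI_min_degree:
  assumes "card (verts G) = d + 1" "\<And>u. u \<in> verts G \<Longrightarrow> d \<le> out_degree G u"
  shows "complete_digraph (d + 1) G"
proof -
  have eq: "sg.nb u = verts G - {u}" if u: "u \<in> verts G" for u
  proof (rule card_seteq)
    show "sg.nb u \<subseteq> verts G - {u}" using sg.nb_subset sg.adj_irrefl by auto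
    show "card (verts G - {u}) \<le> card (sg.nb u)"
      using assms u out_degree_eq by simp
  qed simp
  have "(u, v) \<in> arcs_ends G \<longleftrightarrow> u \<in> verts G \<and> v \<in> verts G \<and> u \<noteq> v" for u v
    using eq[of u] sg.in_nb[of v u] adj_in_verts[of u v] sg.adj_irrefl[of u] by blast
  then show ?thesis unfolding complete_digraph_def using assms graph_axioms by auto
qed

lemma complete_digraph_clique:
  assumes "sg.clique (verts G)"
  shows "complete_digraph (card (verts G)) G"
proof -
  have "(u, v) \<in> arcs_ends G \<longleftrightarrow> u \<in> verts G \<and> v \<in> verts G \<and> u \<noteq> v" for u v
    using assms sg.adj_irrefl[of u] adj_in_verts[of u v] unfolding sg.clique_def by blast
  then show ?thesis unfolding complete_digraph_def using graph_axioms by auto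
qed

lemma odd_cycleI:
  assumes f: "sg.path_enum f n" "f ` {..<n} = verts G"
    and adj_cases: "\<And>i j. i < j \<Longrightarrow> j < n \<Longrightarrow> (f i, f j) \<in> arcs_ends G \<Longrightarrow> j = Suc i \<or> i = 0 \<and> Suc j = n"
    and n: "odd n" "3 \<le> n" and close: "(f 0, f (n - 1)) \<in> arcs_ends G"
  shows "odd_cycle G"
proof -
  have inj: "inj_on f {..<n}" and consec: "\<And>i. Suc i < n \<Longrightarrow> (f i, f (Suc i)) \<in> arcs_ends G"
    using f unfolding sg.path_enum_def by auto
  have cyc: "(f i, f j) \<in> arcs_ends G \<longleftrightarrow> (j = Suc i mod n \<or> i = Suc j mod n)"
    if ij: "i < j" "j < n" for i j
  proof
    assume "(f i, f j) \<in> arcs_ends G"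
    then show "j = Suc i mod n \<or> i = Suc j mod n" using adj_cases[OF ij] ij by auto
  next
    assume "j = Suc i mod n \<or> i = Suc j mod n"
    then show "(f i, f j) \<in> arcs_ends G"
    proof
      assume "j = Suc i mod n"
      then show ?thesis using ij consec[of i] by auto
    next
      assume i: "i = Suc j mod n"
      then have "Suc j = n" using ij by (cases "Suc j < n") auto
      then show ?thesis using i close by auto
    qed
  qed
  let ?C = "with_proj (cycle_graph n)"
  have "nomulti_digraph ?C"
    by unfold_locales (auto simp: cycle_graph_def arc_to_ends_def)
  moreover have "bij_betw f (verts ?C) (verts G)"
    using inj f(2) unfolding bij_betw_def by (simp add: cycle_graph_def)
  moreover have "(i, j) \<in> arcs_ends ?C \<longleftrightarrow> (f i, f j) \<in> arcs_ends G"
    if "i \<in> verts ?C" "j \<in> verts ?C" for i j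
  proof -
    have ij: "i < n" "j < n" using that by (auto simp: cycle_graph_def)
    have "(i, j) \<in> arcs_ends ?C \<longleftrightarrow> (j = Suc i mod n \<or> i = Suc j mod n)"
      using ij by (simp add: cycle_graph_def)
    also have "\<dots> \<longleftrightarrow> (f i, f j) \<in> arcs_ends G"
    proof (rule linorder_cases[of i j])
      assume "i = j"
      \<comment> \<open>\<open>Suc i mod n\<close> is \<open>Suc i\<close>, or \<open>0\<close> if
        \<open>i = n - 1\<close>; with \<open>3 \<le> n\<close> it is never
        \<open>i\<close>.\<close>
      then show ?thesis using sg.adj_irrefl ij n(2) by (cases "Suc i < n") (auto simp: not_less le_Suc_eq)
    next
      assume "j < i"
      then show ?thesis using cyc[of j i] ij sg.adj_commute by blast
    qed (use cyc ij in blast)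
    finally show ?thesis .
  qed
  ultimately have "digraph_iso ?C G" using digraph_iso_bijI nomulti_digraph by blast
  then show ?thesis using n unfolding odd_cycle_def by blast
qed

lemma family_free_mono:
  assumes "family_free \<F> (G \<restriction> B)" "A \<subseteq> B"
  shows "family_free \<F> (G \<restriction> A)"
proof -
  have "subgraph (G \<restriction> A) (G \<restriction> B)"
    using assms(2) by (intro subgraphI) (auto simp: compatible_def)
  then show ?thesis using assms(1) subgraph_trans unfolding family_free_def by blast
qed

end

section \<open>Forbidden copies in a graph\<close>

locale graph_family =
  fixes \<F> :: "('a, 'b) pre_digraph set"
  assumes nonempty: "\<F> \<noteq> {}"
    and members: "F \<in> \<F> \<Longrightarrow> graph F \<and> Digraph_Component.connected F \<and> 2 \<le> card (verts F)"
begin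

abbreviation \<delta> :: nat where
  "\<delta> \<equiv> family_min_degree \<F>"

lemma family_min_degree_le:
  assumes "F \<in> \<F>" "u \<in> verts F"
  shows "\<delta> \<le> out_degree F u"
proof -
  have "\<delta> \<le> min_degree F" unfolding family_min_degree_def
    using assms(1) by (intro cINF_lower) auto
  also have "\<dots> \<le> out_degree F u"
    using members[OF assms(1)] assms(2) by (intro graph.min_degree_le) simp_all
  finally show ?thesis .
qed

text \<open>A vertex of degree \<open>0\<close> would be closed by itself, and a connected member
  would have order \<open>1\<close>.\<close>

lemma family_min_degree_pos: "0 < \<delta>"
proof -
  have "1 \<le> min_degree F" if F: "F \<in> \<F>" for F
  proof -
    interpret F: graph F using members[OF F] by blast
    have ne: "verts F \<noteq> {}" using members[OF F] by auto
    have "1 \<le> out_degree F u" if u: "u \<in> verts F" for u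
    proof (rule ccontr)
      assume "\<not> 1 \<le> out_degree F u"
      then have "card (F.sg.nb u) = 0" by (simp only: F.out_degree_eq not_le less_one)
      then have "F.sg.nb u = {}" using F.sg.finite_nb[of u] card_0_eq by blast
      then have "(u, b) \<notin> arcs_ends F" for b using F.sg.in_nb[of b u] by blast
      then have "{u} = verts F"
        using F.connected_closed_eq[of "{u}"] members[OF F] u F.graph_symmetric by blast
      then have "card (verts F) = 1" by (metis card_1_singleton_iff One_nat_def)
      then show False using members[OF F] by simp
    qed
    then show ?thesis unfolding min_degree_def using ne by simp
  qed
  then show ?thesis unfolding family_min_degree_def
    using nonempty cINF_greatest[of \<F> 1 min_degree] by simp
qed

lemma complete_memberI:
  assumes F: "F \<in> \<F>" and card: "card (verts F) = \<delta> + 1"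
  shows "\<exists>F\<in>\<F>. complete_digraph (\<delta> + 1) F"
  using graph.complete_digraphI_min_degree[of F \<delta>] members[OF F] family_min_degree_le[OF F] card F
  by blast

end

locale graph_with_family = graph G + graph_family \<F>
  for G :: "('v, 'e) pre_digraph" and \<F> :: "('a, 'b) pre_digraph set"
begin

text \<open>Gathers the facts about a forbidden copy. Its degrees are carried over from
  \<open>F\<close>; since the copy need not be induced, they only bound from below the number of
  neighbours inside \<open>verts S\<close>.\<close>

lemma copyE:
  assumes "\<not> family_free \<F> (G \<restriction> U)" and U: "U \<subseteq> verts G"
  obtains S F where "F \<in> \<F>" "digraph_iso F S" "subgraph S G" "subgraph S (G \<restriction> U)"
    "verts S \<subseteq> U" "verts S \<noteq> {}" "card (verts S) = card (verts F)" "Digraph_Component.connected S"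
    "\<forall>u\<in>verts S. \<delta> \<le> out_degree S u"
    "\<forall>u\<in>verts S. out_degree S u \<le> card (sg.nb u \<inter> verts S)"
proof -
  obtain S F where S: "subgraph S (G \<restriction> U)" "F \<in> \<F>" "digraph_iso F S"
    using assms(1) unfolding family_free_def in_family_def by blast
  interpret F: graph F using members[OF S(2)] by blast
  have SG: "subgraph S G" using S(1) subgraph_induce_subgraphI[OF U] subgraph_trans by blast
  obtain hom where hom: "F.digraph_isomorphism hom" "S = app_iso hom F"
    using S(3) unfolding digraph_iso_def by blast
  have verts_S: "verts S = iso_verts hom ` verts F" using hom(2) by simp
  have inj: "inj_on (iso_verts hom) (verts F)" using hom(1) F.digraph_isomorphism_inj_on_verts by blast
  have card: "card (verts S) = card (verts F)" unfolding verts_S using inj by (rule card_image)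
  have conn: "Digraph_Component.connected S"
    using F.connectedI_app_iso members[OF S(2)] hom by blast
  have deg: "\<delta> \<le> out_degree S u" if u: "u \<in> verts S" for u
  proof -
    obtain w where w: "w \<in> verts F" "u = iso_verts hom w" using u verts_S by blast
    then have "out_degree S u = out_degree F w" using F.out_degree_app_iso_eq hom by blast
    then show ?thesis using family_min_degree_le[OF S(2) w(1)] by simp
  qed
  have le: "out_degree S u \<le> card (sg.nb u \<inter> verts S)" if u: "u \<in> verts S" for u
  proof -
    have arcs: "arcs S \<subseteq> arcs G" "tail S = tail G" "head S = head G" "wf_digraph S"
      using SG unfolding subgraph_def compatible_def by auto
    have "head G ` out_arcs S u \<subseteq> sg.nb u \<inter> verts S"
    proof
      fix v assume "v \<in> head G ` out_arcs S u"
      then obtain e where e: "e \<in> arcs S" "tail G e = u" "v = head G e"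
        using arcs by (auto simp: out_arcs_def)
      have "(u, v) \<in> arcs_ends G" using e arcs(1) by (auto simp: arcs_ends_conv)
      moreover have "v \<in> verts S" using wf_digraph.head_in_verts[OF arcs(4) e(1)] e(3) arcs(3) by simp
      ultimately show "v \<in> sg.nb u \<inter> verts S" unfolding Int_iff sg.in_nb by blast
    qed
    moreover have "inj_on (head G) (out_arcs S u)"
      using arcs by (intro inj_onI no_multi_arcs) (auto simp: arc_to_ends_def out_arcs_def)
    ultimately show ?thesis unfolding out_degree_def
      using card_inj_on_le[of "head G" "out_arcs S u" "sg.nb u \<inter> verts S"] by simp
  qed
  have "2 \<le> card (verts S)" using members[OF S(2)] card by simp
  then have "verts S \<noteq> {}" by auto
  then show thesis using that[of F S] S SG card conn deg le unfolding subgraph_def by simp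
qed

lemma not_family_freeI:
  assumes "F \<in> \<F>" "digraph_iso F S" "subgraph S (G \<restriction> U)"
  shows "\<not> family_free \<F> (G \<restriction> U)"
  using assms unfolding family_free_def in_family_def by blast

lemma family_free_empty: "family_free \<F> (G \<restriction> {})"
proof (rule ccontr)
  assume "\<not> ?thesis"
  then show False by (rule copyE) auto
qed

text \<open>A copy avoiding \<open>v\<close> lies in \<open>A\<close>; a copy through
  \<open>v\<close> gives \<open>v\<close> at least \<open>\<delta>\<close> neighbours in
  \<open>A\<close>.\<close>

lemma family_free_insert:
  assumes A: "A \<subseteq> verts G" and v: "v \<in> verts G" and free: "family_free \<F> (G \<restriction> A)"
    and card: "card (sg.nb v \<inter> A) < \<delta>"
  shows "family_free \<F> (G \<restriction> insert v A)"
proof (rule ccontr)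
  assume nf: "\<not> ?thesis"
  have sub: "insert v A \<subseteq> verts G" using A v by blast
  obtain S F where S: "F \<in> \<F>" "digraph_iso F S" "subgraph S G" "verts S \<subseteq> insert v A"
      "\<forall>u\<in>verts S. \<delta> \<le> out_degree S u"
      "\<forall>u\<in>verts S. out_degree S u \<le> card (sg.nb u \<inter> verts S)"
    by (rule copyE[OF nf sub], rule that) assumption+
  show False
  proof (cases "v \<in> verts S")
    case True
    have "sg.nb v \<inter> verts S \<subseteq> sg.nb v \<inter> A"
      using S(4) sg.adj_irrefl[of v] sg.in_nb[of v v] by blast
    then have "card (sg.nb v \<inter> verts S) \<le> card (sg.nb v \<inter> A)" by (intro card_mono) simp_all
    then show False using bspec[OF S(5) True] bspec[OF S(6) True] card by linarith
  next
    case False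
    then have "subgraph S (G \<restriction> A)" using S(3,4) subgraph_induce_subgraphI2[OF S(3)]
      by (auto simp: subgraph_def compatible_def wellformed_induce_subgraph wf_digraph.wellformed)
    then show False using not_family_freeI[OF S(1,2)] free by blast
  qed
qed

text \<open>Within \<open>insert v A\<close>, the only neighbour of \<open>v\<close> is
  \<open>x\<close>, and \<open>x\<close> leads back only to \<open>v\<close>. By connectedness a
  copy through \<open>v\<close> is this single edge, so the member would be
  \<open>K_2\<close>.\<close>

lemma family_free_insert_pair:
  assumes d: "\<delta> = 1" and no_edge: "\<not> (\<exists>F\<in>\<F>. complete_digraph 2 F)"
    and A: "A \<subseteq> verts G" and v: "v \<in> verts G" and free: "family_free \<F> (G \<restriction> A)"
    and nb: "sg.nb v \<inter> A = {x}" "sg.nb x \<inter> A = {}"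
  shows "family_free \<F> (G \<restriction> insert v A)"
proof (rule ccontr)
  assume nf: "\<not> ?thesis"
  have sub: "insert v A \<subseteq> verts G" using A v by blast
  obtain S F where S: "F \<in> \<F>" "digraph_iso F S" "subgraph S G" "verts S \<subseteq> insert v A"
      "verts S \<noteq> {}" "card (verts S) = card (verts F)" "Digraph_Component.connected S"
      "\<forall>u\<in>verts S. \<delta> \<le> out_degree S u"
      "\<forall>u\<in>verts S. out_degree S u \<le> card (sg.nb u \<inter> verts S)"
    by (rule copyE[OF nf sub], rule that) assumption+
  have vS: "v \<in> verts S"
  proof (rule ccontr)
    assume "v \<notin> verts S"
    then have "subgraph S (G \<restriction> A)" using S(3,4) subgraph_induce_subgraphI2[OF S(3)]
      by (auto simp: subgraph_def compatible_def wellformed_induce_subgraph wf_digraph.wellformed)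
    then show False using not_family_freeI[OF S(1,2)] free by blast
  qed
  have nbv: "sg.nb v \<inter> insert v A = {x}" using nb(1) sg.adj_irrefl[of v] sg.in_nb[of v v] by blast
  have nbx: "sg.nb x \<inter> insert v A \<subseteq> {v}" using nb(2) by blast
  have "card (sg.nb v \<inter> verts S) \<noteq> 0" using bspec[OF S(8) vS] bspec[OF S(9) vS] d by linarith
  then have "sg.nb v \<inter> verts S \<noteq> {}" by (metis card.empty)
  then obtain b where b: "b \<in> sg.nb v" "b \<in> verts S" by blast
  then have "b \<in> {x}" unfolding nbv[symmetric] using S(4) by blast
  then have xS: "x \<in> verts S" using b(2) by simp
  interpret S: wf_digraph S using S(3) unfolding subgraph_def by blast
  have ends: "arcs_ends S \<subseteq> arcs_ends G" using S(3) by (rule arcs_ends_mono)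
  have "{v, x} = verts S"
  proof (rule S.connected_closed_eq[OF S(7)])
    show "{v, x} \<subseteq> verts S" using vS xS by simp
    fix a b assume a: "a \<in> {v, x}" and ab: "(a, b) \<in> arcs_ends S \<or> (b, a) \<in> arcs_ends S"
    then have b: "b \<in> insert v A" using S.adj_in_verts S(4) by blast
    have "b \<in> sg.nb a" unfolding sg.in_nb using ab ends graph_symmetric by blast
    then show "b \<in> {v, x}" using a b nbv nbx by blast
  qed simp
  moreover have "v \<noteq> x" using nbv sg.adj_irrefl[of v] sg.in_nb[of v v] by blast
  ultimately have "card (verts S) = 2" by (metis card_2_iff)
  then have "\<exists>F\<in>\<F>. complete_digraph (\<delta> + 1) F" using complete_memberI[OF S(1)] S(6) d by simp
  then show False using no_edge unfolding d one_add_one by blast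
qed

text \<open>Minimum degree \<open>\<delta>\<close> needs \<open>\<delta> + 1\<close> vertices, so a
  copy would fill \<open>U\<close> and its member would be complete.\<close>

lemma family_free_small:
  assumes no_clique: "\<not> (\<exists>F\<in>\<F>. complete_digraph (\<delta> + 1) F)"
    and U: "U \<subseteq> verts G" "card U \<le> \<delta> + 1"
  shows "family_free \<F> (G \<restriction> U)"
proof (rule ccontr)
  assume nf: "\<not> ?thesis"
  obtain S F where S: "F \<in> \<F>" "subgraph S G" "verts S \<subseteq> U"
      "verts S \<noteq> {}" "card (verts S) = card (verts F)"
      "\<forall>u\<in>verts S. \<delta> \<le> out_degree S u"
      "\<forall>u\<in>verts S. out_degree S u \<le> card (sg.nb u \<inter> verts S)"
    by (rule copyE[OF nf U(1)], rule that) assumption+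
  have finU: "finite U" using U(1) finite_verts finite_subset by blast
  then have finS: "finite (verts S)" using S(3) finite_subset by blast
  obtain u where u: "u \<in> verts S" using S(4) by blast
  have "sg.nb u \<inter> verts S \<subseteq> verts S - {u}" using sg.adj_irrefl[of u] sg.in_nb[of u u] by blast
  then have "card (sg.nb u \<inter> verts S) \<le> card (verts S - {u})" using finS by (intro card_mono) auto
  moreover have "card (verts S) \<le> \<delta> + 1" using card_mono[OF finU S(3)] U(2) by simp
  moreover have "Suc (card (verts S - {u})) = card (verts S)" using u finS card_Suc_Diff1 by metis
  ultimately have "card (verts F) = \<delta> + 1" using S(5) bspec[OF S(6) u] bspec[OF S(7) u] by linarith
  then show False using complete_memberI[OF S(1)] no_clique by blast
qed

lemma family_free_independent:
  assumes "U \<subseteq> verts G" "sg.independent U"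
  shows "family_free \<F> (G \<restriction> U)"
proof (rule ccontr)
  assume nf: "\<not> ?thesis"
  obtain S where S: "subgraph S G" "verts S \<subseteq> U" "verts S \<noteq> {}"
      "\<forall>u\<in>verts S. \<delta> \<le> out_degree S u"
      "\<forall>u\<in>verts S. out_degree S u \<le> card (sg.nb u \<inter> verts S)"
    by (rule copyE[OF nf assms(1)], rule that) assumption+
  obtain u where u: "u \<in> verts S" using S(3) by blast
  have "b \<notin> sg.nb u" if "b \<in> verts S" for b
    using S(2) u assms(2) that unfolding sg.independent_def sg.in_nb by blast
  then have "sg.nb u \<inter> verts S = {}" by blast
  then have "card (sg.nb u \<inter> verts S) = 0" by (simp only: card.empty)
  then show False using bspec[OF S(4) u] bspec[OF S(5) u] family_min_degree_pos by linarith
qed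

lemma independent_if_family_free:
  assumes F: "F \<in> \<F>" "complete_digraph 2 F" and U: "U \<subseteq> verts G" and free: "family_free \<F> (G \<restriction> U)"
  shows "sg.independent U"
  unfolding sg.independent_def
proof (intro ballI notI)
  fix a b assume ab: "a \<in> U" "b \<in> U" "(a, b) \<in> arcs_ends G"
  have ne: "a \<noteq> b" using ab(3) sg.adj_irrefl by blast
  have sub: "{a, b} \<subseteq> verts G" using ab U by blast
  let ?S = "G \<restriction> {a, b}"
  interpret S: graph ?S
    using induced_graph_imp_graph[OF induced_induce[OF sub]] digraphI_induced[OF induced_induce[OF sub]]
    by (auto simp: graph_def pseudo_graph_def digraph_def)
  have "a \<rightarrow>\<^bsub>?S\<^esub> b" "b \<rightarrow>\<^bsub>?S\<^esub> a"
    using ab(3) graph_symmetric[OF ab(3)] by (auto simp: arcs_ends_conv)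
  then have "S.sg.clique (verts ?S)" unfolding S.sg.clique_def by auto
  then have "complete_digraph 2 ?S" using S.complete_digraph_clique ne by (simp add: numeral_2_eq_2)
  then have "digraph_iso F ?S" using complete_digraph_iso F(2) by blast
  moreover have "subgraph ?S (G \<restriction> U)"
    using ab(1,2) by (intro subgraphI) (auto simp: compatible_def)
  ultimately show False using not_family_freeI[OF F(1)] free by blast
qed

text \<open>In a copy every vertex already has the maximum degree of \<open>G\<close>, so no arc
  leaves the copy or is missing from it. By connectedness the copy is \<open>G\<close>, which would
  belong to the family.\<close>

lemma family_free_self:
  assumes conn: "Digraph_Component.connected G" and max: "max_degree G = \<delta>"
    and not_in: "\<not> in_family G \<F>"
  shows "family_free \<F> (G \<restriction> verts G)"
proof (rule ccontr)
  assume nf: "\<not> ?thesis"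
  obtain S F where S: "F \<in> \<F>" "digraph_iso F S" "subgraph S G" "verts S \<noteq> {}"
      "\<forall>u\<in>verts S. \<delta> \<le> out_degree S u"
      "\<forall>u\<in>verts S. out_degree S u \<le> card (sg.nb u \<inter> verts S)"
    by (rule copyE[OF nf subset_refl], rule that) assumption+
  have sub: "verts S \<subseteq> verts G" "arcs S \<subseteq> arcs G" "tail S = tail G" "head S = head G" "wf_digraph S"
    using S(3) unfolding subgraph_def compatible_def by auto
  have deg: "out_degree G u \<le> out_degree S u" if "u \<in> verts S" for u
    using out_degree_le_max[of u] max bspec[OF S(5) that] sub(1) that by fastforce
  have nb: "sg.nb u \<subseteq> verts S" if u: "u \<in> verts S" for u
  proof -
    have "sg.nb u \<inter> verts S = sg.nb u"
      using deg[OF u] bspec[OF S(6) u] by (intro card_seteq) (simp_all add: out_degree_eq)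
    then show ?thesis by blast
  qed
  have vS: "verts S = verts G"
  proof (rule connected_closed_eq[OF conn sub(1) S(4)])
    fix a b assume "a \<in> verts S" "(a, b) \<in> arcs_ends G \<or> (b, a) \<in> arcs_ends G"
    then show "b \<in> verts S" using nb[of a] sg.in_nb[of b a] graph_symmetric by blast
  qed
  have "arcs G \<subseteq> arcs S"
  proof
    fix e assume e: "e \<in> arcs G"
    define u where "u = tail G e"
    have "u \<in> verts S" using e vS unfolding u_def by simp
    moreover have "out_arcs S u \<subseteq> out_arcs G u" using sub by (auto simp: out_arcs_def)
    ultimately have "out_arcs S u = out_arcs G u"
      using deg[of u] by (intro card_seteq) (auto simp: out_degree_def)
    moreover have "e \<in> out_arcs G u" using e unfolding u_def by simp
    ultimately show "e \<in> arcs S" by (metis in_out_arcs_conv)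
  qed
  then have "S = G" using sub vS by (intro pre_digraph.equality) auto
  then show False using S(1,2) not_in unfolding in_family_def by blast
qed

lemma ex_max_family_free_set: "\<exists>W. max_family_free_set \<F> G W"
proof -
  have "\<exists>W. (W \<subseteq> verts G \<and> family_free \<F> (G \<restriction> W)) \<and>
    (\<forall>U. U \<subseteq> verts G \<and> family_free \<F> (G \<restriction> U) \<longrightarrow> card U \<le> card W)"
  proof (rule ex_has_greatest_nat[of _ "{}" card "Suc (card (verts G))"])
    show "{} \<subseteq> verts G \<and> family_free \<F> (G \<restriction> {})" using family_free_empty by simp
    show "\<forall>U. U \<subseteq> verts G \<and> family_free \<F> (G \<restriction> U) \<longrightarrow> card U < Suc (card (verts G))"
      by (simp add: card_mono less_Suc_eq_le)
  qed
  then show ?thesis unfolding max_family_free_set_def by auto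
qed

section \<open>Maximum free sets with degenerate complement\<close>

text \<open>The second condition is \<open>(r - 1)\<close>-degeneracy of the rest, in the form
  \<open>greedy_partition\<close> takes.\<close>

definition good_split :: "nat \<Rightarrow> 'v set \<Rightarrow> bool" where
  "good_split r S \<longleftrightarrow> max_family_free_set \<F> G S \<and>
     (\<forall>W\<subseteq>verts G - S. W \<noteq> {} \<longrightarrow> (\<exists>u\<in>W. card (sg.nb u \<inter> W) < r))"

lemma maximum_set_swap:
  assumes "max_degree G = \<delta> + r" "0 < r"
  shows "maximum_set_swap (verts G) (\<lambda>u v. (u, v) \<in> arcs_ends G) (\<lambda>U. family_free \<F> (G \<restriction> U)) \<delta> r"
proof
  show "card (sg.nb v) \<le> \<delta> + r" if "v \<in> verts G" for v
    using out_degree_le_max[OF that] assms(1) by (simp add: out_degree_eq)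
qed (use assms family_free_empty family_free_mono family_free_insert family_min_degree_pos in blast)+

lemma max_set_iff:
  assumes "maximum_set_swap (verts G) (\<lambda>u v. (u, v) \<in> arcs_ends G) (\<lambda>U. family_free \<F> (G \<restriction> U)) \<delta> r"
  shows "maximum_set_swap.max_set (verts G) (\<lambda>U. family_free \<F> (G \<restriction> U)) S \<longleftrightarrow> max_family_free_set \<F> G S"
  unfolding maximum_set_swap.max_set_def[OF assms] max_family_free_set_def by blast

lemma ex_good_split:
  assumes "max_degree G = \<delta> + r" and r: "2 \<le> r" and conn: "Digraph_Component.connected G"
    and ncl: "\<not> complete_digraph (max_degree G + 1) G"
  shows "\<exists>S. good_split r S"
proof -
  interpret M: maximum_set_swap "verts G" "\<lambda>u v. (u, v) \<in> arcs_ends G"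
    "\<lambda>U. family_free \<F> (G \<restriction> U)" \<delta> r
    using maximum_set_swap assms(1) r by simp
  have "\<not> (sg.clique (verts G) \<and> card (verts G) = \<delta> + r + 1)"
    using complete_digraph_clique ncl assms(1) by force
  then obtain S where S: "M.max_set S" "\<And>C. \<not> M.bad S C"
    using M.ex_max_set_no_bad[OF r connected_set_verts[OF conn]] by blast
  then have "good_split r S"
    using M.no_bad_degenerate[OF S] max_set_iff[OF M.maximum_set_swap_axioms] unfolding good_split_def by blast
  then show ?thesis by blast
qed

lemma ex_good_split_degree_two:
  assumes "max_degree G = 2" "\<delta> = 1" and no_edge: "\<not> (\<exists>F\<in>\<F>. complete_digraph 2 F)"
  shows "\<exists>S. good_split 1 S"
proof -
  interpret M: maximum_set_swap "verts G" "\<lambda>u v. (u, v) \<in> arcs_ends G"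
    "\<lambda>U. family_free \<F> (G \<restriction> U)" \<delta> 1
    using maximum_set_swap assms by simp
  obtain S where S: "M.max_set S" "\<And>C. \<not> M.bad S C"
    using M.ex_max_set_no_bad_degree_two[OF assms(2) refl] family_free_insert_pair[OF assms(2) no_edge] by blast
  then have "good_split 1 S"
    using M.no_bad_degenerate[OF S] max_set_iff[OF M.maximum_set_swap_axioms] unfolding good_split_def by blast
  then show ?thesis by blast
qed

text \<open>Any \<open>\<delta> + 1\<close> vertices form a free set, so at most \<open>r\<close>
  vertices remain outside a maximum one, and among so few every degree is below
  \<open>r\<close>.\<close>

lemma ex_good_split_clique:
  assumes "card (verts G) = \<delta> + r + 1" and no_clique: "\<not> (\<exists>F\<in>\<F>. complete_digraph (\<delta> + 1) F)"
  shows "\<exists>S. good_split r S"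
proof -
  obtain S where S: "max_family_free_set \<F> G S" using ex_max_family_free_set by blast
  obtain U where U: "U \<subseteq> verts G" "card U = \<delta> + 1"
    using obtain_subset_with_card_n[of "\<delta> + 1" "verts G"] assms(1) by auto
  then have "family_free \<F> (G \<restriction> U)" using family_free_small[OF no_clique] by simp
  then have "card U \<le> card S" using S U(1) unfolding max_family_free_set_def by blast
  then have small: "card (verts G - S) \<le> r"
    using S U(2) assms(1) card_Diff_subset[of S "verts G"] finite_subset[of S "verts G"]
    unfolding max_family_free_set_def by simp
  have "\<exists>u\<in>W. card (sg.nb u \<inter> W) < r" if W: "W \<subseteq> verts G - S" "W \<noteq> {}" for W
  proof -
    obtain u where u: "u \<in> W" using W(2) by blast
    have finW: "finite W" using finite_subset[OF W(1)] by simp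
    have "sg.nb u \<inter> W \<subset> W" using u sg.adj_irrefl[of u] sg.in_nb[of u u] by blast
    then have "card (sg.nb u \<inter> W) < card W" using finW psubset_card_mono by blast
    also have "\<dots> \<le> card (verts G - S)" using W(1) by (intro card_mono) auto
    finally show ?thesis using small u by force
  qed
  then show ?thesis using S unfolding good_split_def by blast
qed

lemma max_family_free_set_independent:
  assumes F: "F \<in> \<F>" "complete_digraph 2 F" and A: "A \<subseteq> verts G" "sg.independent A"
    and max: "\<And>U. U \<subseteq> verts G \<Longrightarrow> sg.independent U \<Longrightarrow> card U \<le> card A"
  shows "max_family_free_set \<F> G A"
  using family_free_independent[OF A] A(1) max independent_if_family_free[OF F]
  unfolding max_family_free_set_def by blast

end

lemma (in graph) bipartition_degree_two:
  assumes conn: "Digraph_Component.connected G" and deg: "max_degree G = 2" and ne: "verts G \<noteq> {}"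
    and no_odd: "\<not> odd_cycle G"
  shows "\<exists>A\<subseteq>verts G. sg.independent A \<and> sg.independent (verts G - A) \<and>
    (\<forall>U\<subseteq>verts G. sg.independent U \<longrightarrow> card U \<le> card A)"
proof -
  have le: "card (sg.nb v) \<le> 2" if "v \<in> verts G" for v
    using out_degree_le_max[OF that] deg by (simp add: out_degree_eq)
  obtain f n where f: "sg.path_enum f n" "f ` {..<n} = verts G"
    "\<And>i j. i < j \<Longrightarrow> j < n \<Longrightarrow> (f i, f j) \<in> arcs_ends G \<Longrightarrow> j = Suc i \<or> i = 0 \<and> Suc j = n"
    using sg.ex_spanning_path[OF connected_set_verts[OF conn] ne le] by metis
  show ?thesis
    by (rule sg.even_cycle_or_path_bipartition[OF f]) (use odd_cycleI[OF f] no_odd in blast)+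
qed

section \<open>Choice of the class and assembly of the partition\<close>

theorem theorem3:
  fixes k :: nat
    and \<G> :: "nat \<Rightarrow> ('a, 'b) pre_digraph set"
    and d :: "nat \<Rightarrow> nat"
    and H :: "('v, 'e) pre_digraph"
  assumes "k \<ge> 1"
    and "\<And>i. i \<in> {1..k} \<Longrightarrow> \<G> i \<noteq> {}"
    and "\<And>i F. i \<in> {1..k} \<Longrightarrow> F \<in> \<G> i \<Longrightarrow>
           graph F \<and> Digraph_Component.connected F \<and> card (verts F) \<ge> 2"
    and "\<And>i. i \<in> {1..k} \<Longrightarrow> d i = family_min_degree (\<G> i)"
    and "graph H" and "Digraph_Component.connected H"
    and "max_degree H = (\<Sum>i=1..k. d i)"
    and "k = 1 \<Longrightarrow> \<not> in_family H (\<G> 1)"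
    and "(\<forall>i\<in>{1..k}. \<exists>F\<in>\<G> i. complete_digraph (d i + 1) F) \<Longrightarrow>
           \<not> complete_digraph (max_degree H + 1) H"
    and "(\<forall>i\<in>{1..k}. \<exists>F\<in>\<G> i. complete_digraph 2 F) \<Longrightarrow>
           \<not> odd_cycle H \<and> \<not> (\<exists>n. complete_digraph n H)"
  shows "\<exists>V :: nat \<Rightarrow> 'v set.
           disjoint_family_on V {1..k} \<and> (\<Union>i\<in>{1..k}. V i) = verts H \<and>
           (\<forall>i\<in>{1..k}. family_free (\<G> i) (H \<restriction> V i)) \<and>
           (\<exists>i\<in>{1..k}. max_family_free_set (\<G> i) H (V i))"
proof -
  interpret H: graph H by fact
  have family: "graph_with_family H (\<G> i)" if i: "i \<in> {1..k}" for i
    using assms(2)[OF i] assms(3)[OF i] by unfold_locales auto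
  have d_eq: "d i = family_min_degree (\<G> i)" and d_pos: "0 < d i" if i: "i \<in> {1..k}" for i
    using graph_family.family_min_degree_pos[of "\<G> i"] family[OF i] assms(4)[OF i]
    unfolding graph_with_family_def by auto
  have split_sum: "max_degree H = d i + sum d ({1..k} - {i})" if i: "i \<in> {1..k}" for i
    using assms(7) sum.remove[of "{1..k}" i d] i by simp
  \<comment> \<open>A good split for one class \<open>i\<close> suffices:
    \<open>greedy_partition\<close> distributes the remaining vertices over the other
    classes.\<close>
  have extend: ?thesis if i: "i \<in> {1..k}"
    and S: "graph_with_family.good_split H (\<G> i) (sum d ({1..k} - {i})) S" for i S
  proof -
    interpret I: graph_with_family H "\<G> i" by (rule family[OF i])
    have S': "max_family_free_set (\<G> i) H S" "S \<subseteq> verts H" "family_free (\<G> i) (H \<restriction> S)"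
      using S unfolding I.good_split_def max_family_free_set_def by auto
    define J where "J = {1..k} - {i}"
    have "\<exists>U. disjoint_family_on U J \<and> (\<Union>j\<in>J. U j) = verts H - S \<and>
      (\<forall>j\<in>J. family_free (\<G> j) (H \<restriction> U j))"
    proof (rule H.sg.greedy_partition[where d = d])
      fix j assume "j \<in> J"
      then have j: "j \<in> {1..k}" unfolding J_def by blast
      interpret J: graph_with_family H "\<G> j" by (rule family[OF j])
      show "family_free (\<G> j) (H \<restriction> {})" by (rule J.family_free_empty)
      show "family_free (\<G> j) (H \<restriction> insert v A)"
        if "A \<subseteq> verts H" "v \<in> verts H" "family_free (\<G> j) (H \<restriction> A)" "card (H.sg.nb v \<inter> A) < d j" for A v
        using J.family_free_insert[OF that(1-3)] that(4) d_eq[OF j] by simp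
    next
      show "\<exists>u\<in>W. card (H.sg.nb u \<inter> W) < sum d J" if "W \<subseteq> verts H - S" "W \<noteq> {}" for W
        using S that unfolding I.good_split_def J_def by simp
    qed (auto simp: J_def)
    then obtain U where U: "disjoint_family_on U J" "(\<Union>j\<in>J. U j) = verts H - S"
      "\<forall>j\<in>J. family_free (\<G> j) (H \<restriction> U j)" by blast
    define V where "V = U(i := S)"
    have V: "V i = S" "\<And>j. j \<in> J \<Longrightarrow> V j = U j" unfolding V_def J_def by auto
    have all: "{1..k} = insert i J" "i \<notin> J" using i unfolding J_def by auto
    have disj: "U j \<inter> S = {}" if "j \<in> J" for j using U(2) that by blast
    have "disjoint_family_on V {1..k}"
      unfolding disjoint_family_on_def all(1)
    proof (intro ballI impI)
      fix a b assume "a \<in> insert i J" "b \<in> insert i J" "a \<noteq> b"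
      then consider "a = i" "b \<in> J" | "a \<in> J" "b = i" | "a \<in> J" "b \<in> J" "a \<noteq> b" by blast
      then show "V a \<inter> V b = {}"
      proof cases
        case 3
        then show ?thesis using U(1) V(2) unfolding disjoint_family_on_def by simp
      qed (use V disj in auto)
    qed
    moreover have "(\<Union>i\<in>{1..k}. V i) = verts H"
    proof -
      have "(\<Union>i\<in>{1..k}. V i) = S \<union> (\<Union>j\<in>J. U j)" unfolding all(1) using V by simp
      then show ?thesis unfolding U(2) using S'(2) by blast
    qed
    moreover have "\<forall>j\<in>{1..k}. family_free (\<G> j) (H \<restriction> V j)"
      unfolding all(1) using V U(3) S'(3) by simp
    moreover have "max_family_free_set (\<G> i) H (V i)" using S'(1) V(1) by simp
    ultimately show ?thesis using i by blast
  qed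
  \<comment> \<open>The cases are one family, the exceptional complete graph, a class whose
    \<open>r\<close> is at least \<open>2\<close> so that the walk applies, and no such
    class.\<close>
  consider "k = 1" | "k \<noteq> 1" "complete_digraph (max_degree H + 1) H"
    | i where "\<not> complete_digraph (max_degree H + 1) H" "i \<in> {1..k}" "2 \<le> sum d ({1..k} - {i})"
    | "k \<noteq> 1" "\<forall>i\<in>{1..k}. sum d ({1..k} - {i}) \<le> 1"
    by (metis not_less_eq_eq numeral_2_eq_2 One_nat_def)
  then show ?thesis
  proof cases
    case 1
    then have one: "1 \<in> {1..k}" by simp
    interpret I: graph_with_family H "\<G> 1" by (rule family[OF one])
    have "max_degree H = family_min_degree (\<G> 1)" using assms(7) 1 d_eq[OF one] by simp
    then have free: "family_free (\<G> 1) (H \<restriction> verts H)"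
      using I.family_free_self[OF assms(6)] assms(8)[OF 1] by blast
    moreover have "max_family_free_set (\<G> 1) H (verts H)"
      using free unfolding max_family_free_set_def by (simp add: card_mono)
    ultimately show ?thesis
      using 1 by (intro exI[of _ "\<lambda>_. verts H"]) (simp add: disjoint_family_on_def)
  next
    case 2
    \<comment> \<open>If every family contained its complete graph of order \<open>d i + 1\<close>,
      this \<open>H\<close> would be excluded.\<close>
    then obtain i where i: "i \<in> {1..k}" "\<not> (\<exists>F\<in>\<G> i. complete_digraph (d i + 1) F)"
      using assms(9) by blast
    interpret I: graph_with_family H "\<G> i" by (rule family[OF i(1)])
    have "card (verts H) = d i + sum d ({1..k} - {i}) + 1"
      using 2(2) split_sum[OF i(1)] unfolding complete_digraph_def by simp
    then show ?thesis using extend[OF i(1)] I.ex_good_split_clique i(2) d_eq[OF i(1)] by auto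
  next
    case 3
    interpret I: graph_with_family H "\<G> i" by (rule family[OF 3(2)])
    show ?thesis
      using extend[OF 3(2)] I.ex_good_split[OF _ 3(3) assms(6) 3(1)] split_sum[OF 3(2)] d_eq[OF 3(2)] by auto
  next
    case 4
    have k2: "2 \<le> k" using assms(1) 4(1) by simp
    \<comment> \<open>\<open>k - 1\<close> positive summands total at most \<open>1\<close>, so
      there are just two families.\<close>
    have "k - 1 = card ({1..k} - {1})" using k2 by simp
    also have "\<dots> \<le> sum d ({1..k} - {1})"
      using d_pos sum_mono[of "{1..k} - {1}" "\<lambda>_. 1" d] by (simp add: Suc_leI)
    also have "\<dots> \<le> 1" using 4(2) assms(1) by simp
    finally have k: "k = 2" using k2 by simp
    have rest: "{1..k} - {1} = {2}" "{1..k} - {2} = {1}" "{1..k} = {1, 2}" using k by auto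
    have "sum d ({1..k} - {1}) \<le> 1" "sum d ({1..k} - {2}) \<le> 1" using 4(2) k by simp_all
    then have "d 2 \<le> 1" "d 1 \<le> 1" unfolding rest(1,2) by simp_all
    then have d1: "d 1 = 1" "d 2 = 1" using d_pos[of 1] d_pos[of 2] k by auto
    have deg: "max_degree H = 2" using assms(7) d1 unfolding rest(3) by simp
    show ?thesis
    proof (cases "\<forall>i\<in>{1..k}. \<exists>F\<in>\<G> i. complete_digraph 2 F")
      case False
      then obtain i where i: "i \<in> {1..k}" "\<not> (\<exists>F\<in>\<G> i. complete_digraph 2 F)" by blast
      interpret I: graph_with_family H "\<G> i" by (rule family[OF i(1)])
      consider "i = 1" | "i = 2" using i(1) unfolding rest(3) by blast
      then have "d i = 1" "sum d ({1..k} - {i}) = 1" using rest(1,2) d1 by (cases; simp)+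
      then show ?thesis
        using extend[OF i(1)] I.ex_good_split_degree_two[OF deg _ i(2)] d_eq[OF i(1)] by auto
    next
      \<comment> \<open>Both families forbid \<open>K_2\<close>, so free sets are the independent
        sets, and the bipartition of the path or even cycle \<open>H\<close> is the partition
        sought.\<close>
      case True
      have ne: "verts H \<noteq> {}"
        using assms(6) unfolding Digraph_Component.connected_def strongly_connected_def by simp
      obtain A where A: "A \<subseteq> verts H" "H.sg.independent A" "H.sg.independent (verts H - A)"
        "\<And>U. U \<subseteq> verts H \<Longrightarrow> H.sg.independent U \<Longrightarrow> card U \<le> card A"
        using H.bipartition_degree_two[OF assms(6) deg ne] assms(10)[OF True] by blast
      interpret I1: graph_with_family H "\<G> 1" using family k by simp
      interpret I2: graph_with_family H "\<G> 2" using family k by simp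
      obtain F where F: "F \<in> \<G> 1" "complete_digraph 2 F" using True unfolding rest(3) by blast
      define V where "V = (\<lambda>i::nat. if i = 1 then A else verts H - A)"
      have "max_family_free_set (\<G> 1) H (V 1)"
        using I1.max_family_free_set_independent[OF F A(1,2,4)] unfolding V_def by simp
      moreover have "family_free (\<G> 1) (H \<restriction> V 1)" "family_free (\<G> 2) (H \<restriction> V 2)"
        using I1.family_free_independent[OF A(1,2)] I2.family_free_independent[OF _ A(3)]
        unfolding V_def by auto
      moreover have "disjoint_family_on V {1..k}" "(\<Union>i\<in>{1..k}. V i) = verts H"
        using A(1) unfolding rest(3) V_def disjoint_family_on_def by auto
      ultimately show ?thesis unfolding rest(3) by (intro exI[of _ V]) simp
    qed
  qed
qed

end
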